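(* Let $\mathfrak S$ be a generalized triangulable pb surface without interior punctures, with a generalized triangulation $\lambda$. The assignments $A^{\rm qc}_v\mapsto A^{\rm qc}_v$, $v\in\overline V_{\lambda^\ast}$ (sending the initial cluster variable $A_v^{\rm qc}$ of the seed $\mathsf s^{\rm qc}_{\lambda^\ast}$ to the Laurent monomial $A^{\rm qc}_v$ in the cluster variables $\overline A_u$ of the seed $\overline{\mathsf s}_{\lambda^\ast}$), induce a quasi-isomorphism $$f:\ \mathscr A^{\rm qc}_\omega(\mathfrak S^\ast)=\mathscr A_{\mathsf s^{\rm qc}_{\lambda^\ast}}\longrightarrow\overline{\mathscr A}_\omega(\mathfrak S^\ast)=\mathscr A_{\overline{\mathsf s}_{\lambda^\ast}}.$$
   Context: **Constants.** $n$ is a fixed positive integer, $R=\mathbb Z[\omega^{\pm1/2}]$, $\xi=\omega^n$, $q=\omega^{n^2}$ (fractional powers of $q,\xi$ denote the corresponding powers of $\omega^{1/2}$), $\mathbb c_i=(-q)^{i-n}q^{(1-n)/(2n)}$, $\mathbb t=(-1)^{n-1}q^{(1-n^2)/n}$, $\mathbb a=q^{-(n+1-2n^2)/4}$, $[n]=\frac{q^n-q^{-n}}{q-q^{-1}}$, $\bar i=n+1-i$; $\ell(\sigma)$ is the length of $\sigma\in S_n$. **Surfaces.** A pb surface is obtained from a compact oriented surface by removing finitely many points (punctures) so that every boundary component is an open interval (a boundary edge). A puncture is interior if it is not on the boundary of the compact surface. $\mathbb P_k$ is the closed disc with $k$ boundary points removed. The positive orientation of the boundary is the induced one (surface on the left).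 An ideal arc is an embedded open arc whose two ends tend to punctures. A pb surface is triangulable if no component is $\mathbb P_1$, $\mathbb P_2$, a sphere with one or two punctures, or closed; generalized triangulable if each component is triangulable or a bigon $\mathbb P_2$. **Stated skein algebra of a pb surface $\Sigma$.** An $n$-web in $\Sigma\times(-1,1)$ is a properly embedded framed disjoint union of oriented closed curves and a finite oriented graph whose vertices are 1-valent (endpoints, lying on $\partial\Sigma\times(-1,1)$, with distinct heights over each boundary edge and vertical framing) or $n$-valent (each a sink or a source, with a cyclic order of half-edges). A state is a map from endpoints to $\{1,\dots,n\}$. Webs are drawn by diagrams with vertical framing, cyclic orders counterclockwise, and a linear (height) order of endpoints on each boundary edge; a diagram is negatively ordered if heights increase along the negative orientation of each boundary edge. $\mathscr S_\omega(\Sigma)$ is the $R$-module spanned by isotopy classes of stated $n$-webs modulo the local relations: (1) $q^{-1/n}X_+-q^{1/n}X_-=(q^{-1}-q)I$, for two strands directed left to right: in $X_+$ they cross and the strand from upper left to lower right is over, in $X_-$ it is under, $I$ is two parallel strands; (2) a kink whose crossing is of type $X_+$ can be removed with factor $\mathbb t$; (3) a trivial loop equals $(-1)^{n-1}[n]$; (4) a sink receiving $n$ strands from the left next to a source emitting $n$ strands to the right equals $(-q)^{-n(n-1)/2}\sum_{\sigma\in S_n}(-q^{(n-1)/n})^{\ell(\sigma)}\sigma_+$, with $\sigma_+$ the minimal positive ($X_+$ crossings) braid of $\sigma$. Near a boundary edge drawn vertically on the right of the surface with heights increasing downwards (endpoints consecutive in height): (5) an $n$-valent vertex next to the edge, its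 $n$ half-edges going left, equals $\mathbb a\sum_\sigma(-q)^{-\ell(\sigma)}$ times the $n$ strands prolonged to the edge with states $\sigma(n),\dots,\sigma(2),\sigma(1)$ from top to bottom; (6) an arc with both endpoints on the edge, upper state $i$, lower state $j$, cutting off a disc, equals $\delta_{\bar j,i}\mathbb c_i$; (7) a strand making a U-turn next to the edge equals $\sum_{i}\mathbb c_{\bar i}^{-1}$ times the two strands prolonged to the edge with upper state $i$ and lower state $\bar i$; (8) two strands, both oriented towards or both away from the edge, crossing (the one from upper left to lower right over) just before the edge, with upper state $i$ and lower state $j$, equal $q^{1/n}\big(\delta_{j<i}(q^{-1}-q)[i,j]+q^{-\delta_{i,j}}[j,i]\big)$, $[a,b]$ being two parallel strands with upper state $a$, lower state $b$. Product: stacking ($\alpha\alpha'$ is $\alpha$ above $\alpha'$). Reflection $\ast$ is the $\mathbb Z$-linear anti-involution with $\omega^{1/2}\mapsto\omega^{-1/2}$, switching all crossings and reversing height orders; if $\ast(x)=\omega^kx$, put $[x]_{\rm norm}=\omega^{k/2}x$. A bad arc at a boundary puncture $p$ is a corner arc around $p$ (either orientation) with state $i$ on the boundary edge starting at $p$ and $j$ on the boundary edge ending at $p$ (positive orientation), $i<j$. $\overline{\mathscr S}_\omega(\Sigma)$ is $\mathscr S_\omega(\Sigma)$ modulo the two-sided ideal generated by bad arcs. **Triangulations.** A triangulation $\lambda$ is a maximal family of disjoint, pairwise non-isotopic ideal arcs, each puncture being adjacent to at least two arcs; it cuts the surface into triangles (faces). The generalized triangulation of $\mathbb P_2$ is its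 pair of boundary edges. In a triangle label vertices $v_1,v_2,v_3$ clockwise, $e_r$ the edge joining $v_r,v_{r+1}$; small vertices are integer triples $(i,j,k)\ge0$, $i+j+k=n$ (barycentric coordinates), excluding the three corners. The lines $i,j,k=$ const subdivide the triangle; each small edge joining two small vertices is an arrow: on the boundary directed clockwise with weight $\tfrac12$, in the interior directed like the parallel boundary edge with weight $1$. Gluing faces (identifying small vertices on glued edges, cancelling opposite arrows) gives the vertex set $\overline V_\lambda$ and the signed adjacency matrix $\overline Q_\lambda(v,v')$ = (weight of arrows $v\to v'$) − (weight of arrows $v'\to v$). $\mathfrak S^\ast$ is $\mathfrak S$ with a triangle attached to every boundary edge along the edge $e_1$ of that triangle, and $\lambda^\ast$ the induced triangulation (for $\mathbb P_2$: $\mathfrak S^\ast=\mathbb P_4$, $\lambda^\ast$ having the bigon as its diagonal, $\overline V_\lambda$ the small vertices on the diagonal). $V'_\lambda\subset\overline V_{\lambda^\ast}$ is the set of small vertices not on the edges $e_2$ of attached triangles. For $v=(i,j,k)$ in an attached triangle with $k\ne0$, $p(v)=(0,n-k,k)$ in the same triangle. **Seed $\overline{\mathsf s}_{\lambda^\ast}$.** For $v=(i,j,k)$ in a face of $\lambda^\ast$: take an $n$-valent source in the face with $i,j,k$ parallel outgoing edges going to $e_1,e_2,e_3$ respectively, prolonged by turning left in every triangle entered until $\partial\mathfrak S^\ast$ (so these bunches circle the punctures $v_1,v_2,v_3$ counterclockwise); give a bunch of $m$ edges circling $p$ the states $n,n-1,\dots,n+1-m$ in order of increasing distance from $p$, use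 negative order, multiply by $(-1)^{n(n-1)/2}$, take the reflection-normalization; its image in $\overline{\mathscr S}_\omega(\mathfrak S^\ast)$ is $\overline{\mathsf g}_v$. Known: $\overline{\mathsf g}_v\overline{\mathsf g}_{v'}=\xi^{\overline\Pi(v,v')}\overline{\mathsf g}_{v'}\overline{\mathsf g}_v$ for integers $\overline\Pi(v,v')$; there is a unique algebra map from $\overline{\mathscr S}_\omega(\mathfrak S^\ast)$ to the quantum torus generated by $\overline A_v^{\pm1}$ with the same commutation relations sending $\overline{\mathsf g}_v\mapsto\overline A_v$; $\widetilde{\mathscr S}_\omega(\mathfrak S^\ast)$ is the quotient by its kernel. $\overline{\mathsf s}_{\lambda^\ast}$ is the quantum seed in ${\rm Frac}(\widetilde{\mathscr S}_\omega(\mathfrak S^\ast))$ (= the skew field of that quantum torus) with $\mathcal V=\overline V_{\lambda^\ast}$, $\mathcal V_{\rm mut}$ = vertices in the interior of $\mathfrak S^\ast$, exchange matrix $\overline Q_{\lambda^\ast}$, commutation matrix $\overline\Pi$, cluster variables $\overline A_v$. **Quantum cluster algebras.** A quantum seed is $(Q,\Pi,M)$ with $Q$ an exchange matrix, $\Pi$ integral skew-symmetric with $\sum_kQ(k,u)\Pi(k,v)=\delta_{u,v}d_u$ ($d_u>0$, $u$ mutable), and $M({\bf k})M({\bf t})=\xi^{\frac12{\bf k}\Pi{\bf t}^T}M({\bf k}+{\bf t})$; $A_v=M({\bf e}_v)$ and $[\prod A_v^{k_v}]:=M({\bf k})$. Mutation at mutable $k$ mutates $Q$ as usual and replaces $A_k$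 by $M(-{\bf e}_k+\sum_j[Q(j,k)]_+{\bf e}_j)+M(-{\bf e}_k+\sum_j[-Q(j,k)]_+{\bf e}_j)$. $\mathscr A_{\mathsf s}$ is the $R$-algebra generated by all cluster variables of all seeds mutation-equivalent to $\mathsf s$ and the inverses of the frozen ones. **Seed $\mathsf s^{\rm qc}_{\lambda^\ast}$.** $A_v^{\rm qc}=[\overline A_v\overline A_{p(v)}^{-1}]$ for $v\in V'_\lambda\setminus\overline V_\lambda$ and $A_v^{\rm qc}=\overline A_v$ for the other $v\in\overline V_{\lambda^\ast}$. $\mathsf s^{\rm qc}_{\lambda^\ast}$ is the quantum seed in ${\rm Frac}(\overline{\mathscr A}_\omega(\mathfrak S^\ast))$ with vertex set $\overline V_{\lambda^\ast}$, mutable vertices the interior ones, cluster variables $A^{\rm qc}_v$ (commutation matrix determined by them), and exchange matrix $Q^{\rm qc}_{\lambda^\ast}$ obtained from $\overline Q_{\lambda^\ast}$ by deleting all arrows incident to $\overline V_{\lambda^\ast}\setminus V'_\lambda$. **Quasi-homomorphism.** Let $\mathsf s=(Q,\Pi,M)$, $\mathsf s'=(Q',\Pi',M')$ be quantum seeds with the same mutable vertex set $\mathcal V_{\rm mut}$, vertex sets $\mathcal V,\mathcal V'$. An $R$-algebra homomorphism $\varphi:\mathscr A_{\mathsf s}\to\mathscr A_{\mathsf s'}$ is a quantum quasi-homomorphism if: (1) $Q|_{\mathcal V_{\rm mut}}=Q'|_{\mathcal V_{\rm mut}}$; (2) for $v\in\mathcal V_{\rm mut}$, $\varphi(M({\bf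 e}_v))=M'({\bf f}_v)$ where the $v$-coordinate of ${\bf f}_v$ is $1$ and its other mutable coordinates are $0$; (3) for $v\in\mathcal V\setminus\mathcal V_{\rm mut}$, $\varphi(M({\bf e}_v))=M'({\bf f}_v)$ where ${\bf f}_v$ has zero mutable coordinates; (4) $\varphi(M(Q(-,v)))=M'(Q'(-,v))$ for all $v\in\mathcal V_{\rm mut}$. A quasi-isomorphism is a quasi-homomorphism that is an algebra isomorphism. *)

theory Defs
  imports
    "HOL-Complex_Analysis.Complex_Analysis"
    "HOL-Library.Poly_Mapping"
    "HOL-Combinatorics.Permutations"
    "HOL-Algebra.Ring"
begin

section \<open>Oriented surfaces and pb surfaces\<close>

definition half_plane :: "complex set" where
  "half_plane = {z. 0 \<le> Im z}"

text \<open>An oriented topological surface is given by its underlying space and an oriented atlas with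
  values in the closed upper half plane. Local orientations are compared by winding numbers of the
  images of small circles.\<close>

record 'a osurf =
  spc :: "'a topology"
  charts :: "('a set \<times> ('a \<Rightarrow> complex)) set"

definition pos_at :: "(complex \<Rightarrow> complex) \<Rightarrow> complex \<Rightarrow> real \<Rightarrow> bool" where
  "pos_at f z r \<longleftrightarrow> winding_number (f \<circ> circlepath z r) (f z) = 1"

definition chart_on :: "'a topology \<Rightarrow> 'a set \<Rightarrow> ('a \<Rightarrow> complex) \<Rightarrow> bool" where
  "chart_on X U \<psi> \<longleftrightarrow> openin X U \<and>
     (\<exists>W. openin (top_of_set half_plane) W \<and> homeomorphic_map (subtopology X U) (top_of_set W) \<psi>)"

definition oriented_surface :: "('a, 'm) osurf_scheme \<Rightarrow> bool" where
  "oriented_surface \<Sigma> \<longleftrightarrow>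
     Hausdorff_space (spc \<Sigma>) \<and> second_countable (spc \<Sigma>) \<and>
     (\<forall>(U, \<psi>) \<in> charts \<Sigma>. chart_on (spc \<Sigma>) U \<psi>) \<and>
     topspace (spc \<Sigma>) = \<Union> (fst ` charts \<Sigma>) \<and>
     (\<forall>(U, \<psi>) \<in> charts \<Sigma>. \<forall>(U', \<psi>') \<in> charts \<Sigma>. \<forall>z r.
        0 < r \<and> cball z r \<subseteq> \<psi> ` (U \<inter> U') \<inter> {w. 0 < Im w}
        \<longrightarrow> pos_at (\<psi>' \<circ> inv_into U \<psi>) z r)"

definition bdry :: "('a, 'm) osurf_scheme \<Rightarrow> 'a set" where
  "bdry \<Sigma> = {x. \<exists>(U, \<psi>) \<in> charts \<Sigma>. x \<in> U \<and> Im (\<psi> x) = 0}"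

definition intr :: "('a, 'm) osurf_scheme \<Rightarrow> 'a set" where
  "intr \<Sigma> = topspace (spc \<Sigma>) - bdry \<Sigma>"

definition bedges :: "('a, 'm) osurf_scheme \<Rightarrow> 'a set set" where
  "bedges \<Sigma> = connected_components_of (subtopology (spc \<Sigma>) (bdry \<Sigma>))"

definition oriented_embedding ::
    "('a, 'm) osurf_scheme \<Rightarrow> complex set \<Rightarrow> (complex \<Rightarrow> 'a) \<Rightarrow> bool" where
  "oriented_embedding \<Sigma> D \<phi> \<longleftrightarrow> embedding_map (top_of_set D) (spc \<Sigma>) \<phi> \<and>
     (\<forall>(U, \<psi>) \<in> charts \<Sigma>. \<forall>z r. 0 < r \<and> cball z r \<subseteq> interior D \<and> \<phi> ` cball z r \<subseteq> U
        \<longrightarrow> pos_at (\<psi> \<circ> \<phi>) z r)"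

text \<open>A pb surface is recorded by the compact surface together with its punctures;
  \<open>opn\<close> is the surface with the punctures removed.\<close>

record 'a pbsurf = "'a osurf" +
  punct :: "'a set"

definition opn :: "'a pbsurf \<Rightarrow> 'a osurf" where
  "opn S = \<lparr> spc = subtopology (spc S) (topspace (spc S) - punct S),
             charts = (\<lambda>(U, \<psi>). (U - punct S, \<psi>)) ` charts S \<rparr>"

definition pb_surface :: "'a pbsurf \<Rightarrow> bool" where
  "pb_surface S \<longleftrightarrow> oriented_surface S \<and> compact_space (spc S) \<and>
     finite (punct S) \<and> punct S \<subseteq> topspace (spc S) \<and>
     (\<forall>b \<in> bedges (opn S). subtopology (spc S) b homeomorphic_space euclideanreal)"

definition no_interior_punctures :: "'a pbsurf \<Rightarrow> bool" where
  "no_interior_punctures S \<longleftrightarrow> punct S \<subseteq> bdry S"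

abbreviation comps :: "'a pbsurf \<Rightarrow> 'a set set" where
  "comps S \<equiv> connected_components_of (spc S)"

text \<open>\<open>is_polygon S k C\<close>: the component \<open>C\<close> is a closed disc with \<open>k\<close> boundary points removed.\<close>

definition is_polygon :: "'a pbsurf \<Rightarrow> nat \<Rightarrow> 'a set \<Rightarrow> bool" where
  "is_polygon S k C \<longleftrightarrow>
     subtopology (spc S) C homeomorphic_space top_of_set (cball 0 1 :: complex set) \<and>
     punct S \<inter> C \<subseteq> bdry S \<and> card (punct S \<inter> C) = k"

definition is_sphere :: "'a pbsurf \<Rightarrow> nat \<Rightarrow> 'a set \<Rightarrow> bool" where
  "is_sphere S k C \<longleftrightarrow>
     subtopology (spc S) C homeomorphic_space top_of_set (sphere 0 1 :: (real ^ 3) set) \<and>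
     card (punct S \<inter> C) = k"

definition triangulable_comp :: "'a pbsurf \<Rightarrow> 'a set \<Rightarrow> bool" where
  "triangulable_comp S C \<longleftrightarrow>
     \<not> is_polygon S 1 C \<and> \<not> is_polygon S 2 C \<and> \<not> is_sphere S 1 C \<and> \<not> is_sphere S 2 C \<and>
     punct S \<inter> C \<noteq> {}"

definition generalized_triangulable :: "'a pbsurf \<Rightarrow> bool" where
  "generalized_triangulable S \<longleftrightarrow> (\<forall>C \<in> comps S. triangulable_comp S C \<or> is_polygon S 2 C)"


section \<open>Ideal arcs and triangulations\<close>

definition arc_param :: "'a pbsurf \<Rightarrow> (real \<Rightarrow> 'a) \<Rightarrow> bool" where
  "arc_param S g \<longleftrightarrow> pathin (spc S) g \<and> inj_on g {0<..<1} \<and>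
     g 0 \<in> punct S \<and> g 1 \<in> punct S \<and> g ` {0<..<1} \<inter> punct S = {}"

definition ideal_arc :: "'a pbsurf \<Rightarrow> 'a set \<Rightarrow> bool" where
  "ideal_arc S a \<longleftrightarrow> (\<exists>g. arc_param S g \<and> a = g ` {0<..<1})"

definition isotopic_arcs :: "'a pbsurf \<Rightarrow> 'a set \<Rightarrow> 'a set \<Rightarrow> bool" where
  "isotopic_arcs S a b \<longleftrightarrow>
     (\<exists>H. continuous_map (prod_topology (top_of_set {0..1::real}) (top_of_set {0..1::real}))
            (spc S) (\<lambda>(s, t). H s t) \<and>
          (\<forall>s \<in> {0..1}. arc_param S (H s)) \<and>
          H 0 ` {0<..<1} = a \<and> H 1 ` {0<..<1} = b)"

text \<open>An arc is trivial if it contracts onto a puncture, i.e. cuts off a monogon. Trivial arcs are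
  never allowed in a triangulation (the notion of maximal family would otherwise be degenerate).\<close>

definition trivial_arc :: "'a pbsurf \<Rightarrow> 'a set \<Rightarrow> bool" where
  "trivial_arc S a \<longleftrightarrow>
     (\<exists>g H. \<exists>p \<in> punct S. arc_param S g \<and> a = g ` {0<..<1} \<and>
          continuous_map (prod_topology (top_of_set {0..1::real}) (top_of_set {0..1::real}))
            (subtopology (spc S) (insert p (topspace (spc S) - punct S))) (\<lambda>(s, t). H s t) \<and>
          (\<forall>t \<in> {0..1}. H 0 t = g t \<and> H 1 t = p) \<and>
          (\<forall>s \<in> {0..1}. H s 0 = p \<and> H s 1 = p))"

definition triangulation :: "'a pbsurf \<Rightarrow> 'a set \<Rightarrow> 'a set set \<Rightarrow> bool" where
  "triangulation S C L \<longleftrightarrow> finite L \<and>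
     (\<forall>a \<in> L. ideal_arc S a \<and> \<not> trivial_arc S a \<and> a \<subseteq> C) \<and>
     pairwise disjnt L \<and> pairwise (\<lambda>a b. \<not> isotopic_arcs S a b) L \<and>
     (\<forall>a. ideal_arc S a \<and> \<not> trivial_arc S a \<and> a \<subseteq> C \<and> a \<notin> L
        \<longrightarrow> (\<exists>b \<in> L. \<not> disjnt a b \<or> isotopic_arcs S a b)) \<and>
     {b \<in> bedges (opn S). b \<subseteq> C} \<subseteq> L \<and>
     (\<forall>p \<in> punct S \<inter> C. 2 \<le> card {a \<in> L. p \<in> spc S closure_of a})"

definition generalized_triangulation :: "'a pbsurf \<Rightarrow> 'a set set \<Rightarrow> bool" where
  "generalized_triangulation S \<Lambda> \<longleftrightarrow> finite \<Lambda> \<and> (\<forall>a \<in> \<Lambda>. \<exists>C \<in> comps S. a \<subseteq> C) \<and>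
     (\<forall>C \<in> comps S.
        if is_polygon S 2 C
        then {a \<in> \<Lambda>. a \<subseteq> C} = {b \<in> bedges (opn S). b \<subseteq> C} \<and> card {a \<in> \<Lambda>. a \<subseteq> C} = 2
        else triangulation S C {a \<in> \<Lambda>. a \<subseteq> C})"

text \<open>The standard triangle. Its vertices are labelled clockwise by \<open>1, 2, 3\<close> and \<open>side r\<close> is the
  open side joining vertex \<open>r\<close> to vertex \<open>nxt r\<close>.\<close>

definition nxt :: "nat \<Rightarrow> nat" where
  "nxt r = (if r = 1 then 2 else if r = 2 then 3 else 1)"

definition crn :: "nat \<Rightarrow> complex" where
  "crn r = (if r = 1 then 0 else if r = 2 then \<i> else 1)"

definition corners :: "complex set" where
  "corners = crn ` {1, 2, 3}"

definition triangle :: "complex set" where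
  "triangle = convex hull corners"

definition epnt :: "nat \<Rightarrow> real \<Rightarrow> complex" where
  "epnt r s = s *\<^sub>R crn r + (1 - s) *\<^sub>R crn (nxt r)"

definition side :: "nat \<Rightarrow> complex set" where
  "side r = epnt r ` {0<..<1}"

text \<open>The faces of a generalized triangulation, parametrized by the standard triangle; a bigon
  component has no face.\<close>

definition bigon_arc :: "'a pbsurf \<Rightarrow> 'a set \<Rightarrow> bool" where
  "bigon_arc S a \<longleftrightarrow> (\<exists>C \<in> comps S. is_polygon S 2 C \<and> a \<subseteq> C)"

definition faces_of ::
    "'a pbsurf \<Rightarrow> 'a set set \<Rightarrow> 'f set \<Rightarrow> ('f \<Rightarrow> complex \<Rightarrow> 'a) \<Rightarrow> bool" where
  "faces_of S \<Lambda> F \<tau> \<longleftrightarrow> finite F \<and>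
     (\<forall>f \<in> F. continuous_map (top_of_set triangle) (spc S) (\<tau> f) \<and> \<tau> f ` corners \<subseteq> punct S \<and>
        oriented_embedding (opn S) (triangle - corners) (\<tau> f) \<and>
        (\<forall>r \<in> {1, 2, 3}. \<tau> f ` side r \<in> \<Lambda>)) \<and>
     bij_betw (\<lambda>f. \<tau> f ` interior triangle) F
       {K \<in> connected_components_of (subtopology (spc S) (topspace (spc S) - punct S - \<Union>\<Lambda>)).
          \<not> bigon_arc S K} \<and>
     (\<forall>a \<in> \<Lambda>. \<not> bigon_arc S a \<longrightarrow>
        card {(f, r) \<in> F \<times> {1, 2, 3}. \<tau> f ` side r = a} = (if a \<in> bedges (opn S) then 1 else 2))"


section \<open>Surfaces glued from triangles, and the extended surface\<close>

text \<open>A gluing pattern is a symmetric set of pairs of sides \<open>(t, r)\<close>; glued sides are identified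
  by the affine map reversing the orientation. The surface is the quotient of the disjoint union of
  the triangles without corners, so its points are equivalence classes.\<close>

type_synonym 't gluing = "(('t \<times> nat) \<times> ('t \<times> nat)) set"

definition pcls :: "'t gluing \<Rightarrow> 't \<Rightarrow> complex \<Rightarrow> ('t \<times> complex) set" where
  "pcls gl t z = insert (t, z)
     {(t', epnt r' (1 - s)) | t' r' r s. ((t, r), (t', r')) \<in> gl \<and> 0 < s \<and> s < 1 \<and> z = epnt r s}"

definition glued_space :: "'t set \<Rightarrow> 't gluing \<Rightarrow> ('t \<times> complex) set topology" where
  "glued_space T gl = topology (\<lambda>U. U \<subseteq> (\<Union>t \<in> T. pcls gl t ` (triangle - corners)) \<and>
     (\<forall>t \<in> T. openin (top_of_set (triangle - corners)) {z \<in> triangle - corners. pcls gl t z \<in> U}))"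

definition glued :: "'t set \<Rightarrow> 't gluing \<Rightarrow> ('t \<times> complex) set osurf" where
  "glued T gl = \<lparr> spc = glued_space T gl,
     charts = {(U, \<psi>). chart_on (glued_space T gl) U \<psi> \<and>
       (\<forall>t \<in> T. \<forall>z r. 0 < r \<and> cball z r \<subseteq> interior triangle \<and> pcls gl t ` cball z r \<subseteq> U
          \<longrightarrow> pos_at (\<psi> \<circ> pcls gl t) z r)} \<rparr>"

text \<open>The extended surface is glued from the faces of the triangulation and one attached triangle
  for every boundary edge. The two triangles attached to a bigon component are glued directly to
  each other along their first sides, which gives the square with the bigon as its diagonal.\<close>

datatype ('f, 'b) tri = Core 'f | Att 'b

definition star_tris :: "'a pbsurf \<Rightarrow> 'f set \<Rightarrow> ('f, 'a set) tri set" where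
  "star_tris S F = Core ` F \<union> Att ` bedges (opn S)"

definition star_gl ::
    "'a pbsurf \<Rightarrow> 'f set \<Rightarrow> ('f \<Rightarrow> complex \<Rightarrow> 'a) \<Rightarrow> ('f, 'a set) tri gluing" where
  "star_gl S F \<tau> =
     {((Core f, r), (Core f', r')) | f r f' r'. f \<in> F \<and> f' \<in> F \<and> r \<in> {1, 2, 3} \<and> r' \<in> {1, 2, 3} \<and>
        (f, r) \<noteq> (f', r') \<and> \<tau> f ` side r = \<tau> f' ` side r'} \<union>
     {((Core f, r), (Att b, 1)) | f r b. f \<in> F \<and> r \<in> {1, 2, 3} \<and> b \<in> bedges (opn S) \<and>
        \<not> bigon_arc S b \<and> \<tau> f ` side r = b} \<union>
     {((Att b, 1), (Core f, r)) | f r b. f \<in> F \<and> r \<in> {1, 2, 3} \<and> b \<in> bedges (opn S) \<and>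
        \<not> bigon_arc S b \<and> \<tau> f ` side r = b} \<union>
     {((Att b, 1), (Att b', 1)) | b b'. b \<in> bedges (opn S) \<and> b' \<in> bedges (opn S) \<and> b \<noteq> b' \<and>
        (\<exists>C \<in> comps S. is_polygon S 2 C \<and> b \<subseteq> C \<and> b' \<subseteq> C)}"


section \<open>Small vertices and the signed adjacency matrix\<close>

type_synonym svert = "nat \<times> nat \<times> nat"

definition co :: "nat \<Rightarrow> svert \<Rightarrow> nat" where
  "co r = (\<lambda>(i, j, k). if r = 1 then i else if r = 2 then j else k)"

definition smalls :: "nat \<Rightarrow> svert set" where
  "smalls n = {(i, j, k). i + j + k = n \<and> i < n \<and> j < n \<and> k < n}"

text \<open>The small vertex on side \<open>r\<close> with coordinates \<open>a\<close> at \<open>r\<close> and \<open>n - a\<close> at \<open>nxt r\<close>.\<close>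

definition sidev :: "nat \<Rightarrow> nat \<Rightarrow> nat \<Rightarrow> svert" where
  "sidev n r a = (if r = 1 then (a, n - a, 0) else if r = 2 then (0, a, n - a) else (n - a, 0, a))"

type_synonym 't vert = "('t \<times> svert) set"

definition vcls :: "nat \<Rightarrow> 't gluing \<Rightarrow> 't \<Rightarrow> svert \<Rightarrow> 't vert" where
  "vcls n gl t x = insert (t, x)
     {(t', sidev n r' (n - a)) | t' r' r a. ((t, r), (t', r')) \<in> gl \<and> 0 < a \<and> a < n \<and> x = sidev n r a}"

definition Vbar :: "nat \<Rightarrow> 't set \<Rightarrow> 't gluing \<Rightarrow> 't vert set" where
  "Vbar n T gl = {vcls n gl t x | t x. t \<in> T \<and> x \<in> smalls n}"

definition Vmut :: "nat \<Rightarrow> 't set \<Rightarrow> 't gluing \<Rightarrow> 't vert set" where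
  "Vmut n T gl = {v \<in> Vbar n T gl. \<forall>(t, x) \<in> v. \<forall>r \<in> {1, 2, 3}.
     co (nxt (nxt r)) x = 0 \<longrightarrow> (t, r) \<in> Domain gl}"

definition small_arrow :: "nat \<Rightarrow> svert \<Rightarrow> svert \<Rightarrow> bool" where
  "small_arrow r x y \<longleftrightarrow> co r x = co r y + 1 \<and> co (nxt r) y = co (nxt r) x + 1 \<and>
     co (nxt (nxt r)) y = co (nxt (nxt r)) x"

text \<open>Arrows parallel to side \<open>r\<close> point from vertex \<open>r\<close> towards vertex \<open>nxt r\<close>.\<close>

definition arrow_weight :: "svert \<Rightarrow> svert \<Rightarrow> rat" where
  "arrow_weight x y = (\<Sum>r \<in> {1, 2, 3}. if small_arrow r x y
     then (if co (nxt (nxt r)) x = 0 then 1 / 2 else 1) else 0)"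

definition Qbar :: "'t vert \<Rightarrow> 't vert \<Rightarrow> rat" where
  "Qbar v w = (\<Sum>((t, x), (t', y)) \<in> v \<times> w.
     if t = t' then arrow_weight x y - arrow_weight y x else 0)"


section \<open>Web diagrams\<close>

text \<open>A stated web diagram is a finite set of oriented arcs with a real level each, together with
  a function giving the states at the endpoints on the boundary. The arcs are pieces of the edges:
  consecutive pieces meet in a point where one arc ends and another one begins, an \<open>n\<close>-valent vertex
  is an interior point where \<open>n\<close> arcs begin or \<open>n\<close> arcs end. Levels only matter at crossings (the arc
  with the larger level is over) and at boundary endpoints (where they are the heights). Framings are
  vertical and the cyclic order at a vertex is the counterclockwise one.\<close>

type_synonym 'a larc = "(real \<Rightarrow> 'a) \<times> real"
type_synonym 'a dgm = "'a larc set \<times> ('a \<Rightarrow> nat)"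

definition arc_trace :: "'a larc \<Rightarrow> 'a set" where
  "arc_trace a = fst a ` {0..1}"

definition arc_inner :: "'a larc \<Rightarrow> 'a set" where
  "arc_inner a = fst a ` {0<..<1}"

definition arc_ends :: "'a larc \<Rightarrow> 'a set" where
  "arc_ends a = {fst a 0, fst a 1}"

definition crossings :: "'a larc set \<Rightarrow> 'a set" where
  "crossings A = {x. \<exists>a \<in> A. \<exists>b \<in> A. a \<noteq> b \<and> x \<in> arc_inner a \<and> x \<in> arc_inner b}"

definition same_bedge :: "('a, 'm) osurf_scheme \<Rightarrow> 'a \<Rightarrow> 'a \<Rightarrow> bool" where
  "same_bedge \<Sigma> x y \<longleftrightarrow> (\<exists>e \<in> bedges \<Sigma>. x \<in> e \<and> y \<in> e)"

definition sq :: "complex set" where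
  "sq = {z. \<bar>Re z\<bar> \<le> 1 \<and> \<bar>Im z\<bar> \<le> 1}"

definition transversal :: "('a, 'm) osurf_scheme \<Rightarrow> 'a larc set \<Rightarrow> 'a larc \<Rightarrow> 'a larc \<Rightarrow> 'a \<Rightarrow> bool" where
  "transversal \<Sigma> A a b x \<longleftrightarrow> (\<exists>\<phi>. oriented_embedding \<Sigma> sq \<phi> \<and> \<phi> ` sq \<subseteq> intr \<Sigma> \<and> \<phi> 0 = x \<and>
     {z \<in> sq. \<phi> z \<in> arc_trace a} = {z \<in> sq. Re z = Im z} \<and>
     {z \<in> sq. \<phi> z \<in> arc_trace b} = {z \<in> sq. Re z = - Im z} \<and>
     (\<forall>c \<in> A - {a, b}. arc_trace c \<inter> \<phi> ` sq = {}))"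

definition is_diagram :: "nat \<Rightarrow> ('a, 'm) osurf_scheme \<Rightarrow> 'a dgm \<Rightarrow> bool" where
  "is_diagram n \<Sigma> = (\<lambda>(A, st). finite A \<and>
     (\<forall>a \<in> A. pathin (spc \<Sigma>) (fst a) \<and> inj_on (fst a) {0..1} \<and> arc_inner a \<subseteq> intr \<Sigma>) \<and>
     (\<forall>x \<in> \<Union> (arc_ends ` A). (\<forall>a \<in> A. x \<notin> arc_inner a) \<and>
        (let out = card {a \<in> A. fst a 0 = x}; inc = card {a \<in> A. fst a 1 = x} in
         if x \<in> bdry \<Sigma> then inc + out = 1 \<and> st x \<in> {1..n}
         else (inc, out) \<in> {(1, 1), (n, 0), (0, n)})) \<and>
     finite (crossings A) \<and>
     (\<forall>a \<in> A. \<forall>b \<in> A. a \<noteq> b \<longrightarrow>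
        (\<forall>x \<in> arc_inner a \<inter> arc_inner b. snd a \<noteq> snd b \<and> transversal \<Sigma> A a b x)) \<and>
     (\<forall>a \<in> A. \<forall>b \<in> A. \<forall>x \<in> arc_ends a. \<forall>y \<in> arc_ends b. x \<noteq> y \<and> same_bedge \<Sigma> x y \<longrightarrow> snd a \<noteq> snd b))"

text \<open>Ambient isotopy, reparametrization of the arcs, and changes of levels that keep the crossing
  data and the height orders.\<close>

definition isotopic_dgm :: "nat \<Rightarrow> ('a, 'm) osurf_scheme \<Rightarrow> 'a dgm \<Rightarrow> 'a dgm \<Rightarrow> bool" where
  "isotopic_dgm n \<Sigma> = (\<lambda>(A, st) (A', st'). is_diagram n \<Sigma> (A, st) \<and> is_diagram n \<Sigma> (A', st') \<and>
     (\<exists>H \<beta>. continuous_map (prod_topology (top_of_set {0..1::real}) (spc \<Sigma>)) (spc \<Sigma>) (\<lambda>(t, x). H t x) \<and>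
        (\<forall>t \<in> {0..1}. homeomorphic_map (spc \<Sigma>) (spc \<Sigma>) (H t)) \<and>
        (\<forall>x \<in> topspace (spc \<Sigma>). H 0 x = x) \<and>
        bij_betw \<beta> A A' \<and>
        (\<forall>a \<in> A. arc_trace (\<beta> a) = H 1 ` arc_trace a \<and> fst (\<beta> a) 0 = H 1 (fst a 0)) \<and>
        (\<forall>a \<in> A. \<forall>b \<in> A.
           arc_inner a \<inter> arc_inner b \<noteq> {} \<or> (\<exists>x \<in> arc_ends a. \<exists>y \<in> arc_ends b. same_bedge \<Sigma> x y)
           \<longrightarrow> (snd a < snd b \<longleftrightarrow> snd (\<beta> a) < snd (\<beta> b))) \<and>
        (\<forall>x \<in> \<Union> (arc_ends ` A) \<inter> bdry \<Sigma>. st' (H 1 x) = st x)))"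

definition subdivision :: "nat \<Rightarrow> ('a, 'm) osurf_scheme \<Rightarrow> 'a dgm \<Rightarrow> 'a dgm \<Rightarrow> bool" where
  "subdivision n \<Sigma> D D' \<longleftrightarrow> is_diagram n \<Sigma> D \<and> is_diagram n \<Sigma> D' \<and>
     (\<exists>A st g g1 g2 l. D = (insert (g, l) A, st) \<and> D' = (insert (g1, l) (insert (g2, l) A), st) \<and>
        g1 0 = g 0 \<and> g1 1 = g2 0 \<and> g2 1 = g 1 \<and> g ` {0..1} = g1 ` {0..1} \<union> g2 ` {0..1})"


section \<open>Coefficients and the free module on diagrams\<close>

text \<open>Laurent polynomials in the square root of \<open>\<omega>\<close>: \<open>om k\<close> is \<open>\<omega>\<close> to the power \<open>k/2\<close>,
  \<open>qp n a b\<close> is \<open>q\<close> to the power \<open>a/b\<close> (used only when \<open>b\<close> divides \<open>2 n\<^sup>2 a\<close>), and \<open>mq n k\<close> is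
  \<open>-q\<close> to the power \<open>k\<close>.\<close>

type_synonym lring = "int \<Rightarrow>\<^sub>0 int"

definition om :: "int \<Rightarrow> lring" where
  "om k = Poly_Mapping.single k 1"

definition qp :: "nat \<Rightarrow> int \<Rightarrow> int \<Rightarrow> lring" where
  "qp n a b = om (2 * (int n)\<^sup>2 * a div b)"

definition mq :: "nat \<Rightarrow> int \<Rightarrow> lring" where
  "mq n k = (if even k then qp n k 1 else - qp n k 1)"

definition cc :: "nat \<Rightarrow> nat \<Rightarrow> lring" where
  "cc n i = mq n (int i - int n) * qp n (1 - int n) (2 * int n)"

definition cc_inv :: "nat \<Rightarrow> nat \<Rightarrow> lring" where
  "cc_inv n i = mq n (int n - int i) * qp n (int n - 1) (2 * int n)"

definition tt :: "nat \<Rightarrow> lring" where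
  "tt n = (-1) ^ (n - 1) * qp n (1 - (int n)\<^sup>2) (int n)"

definition aa :: "nat \<Rightarrow> lring" where
  "aa n = qp n (- (int n + 1 - 2 * (int n)\<^sup>2)) 4"

definition qint :: "nat \<Rightarrow> lring" where
  "qint n = (\<Sum>k < n. qp n (int n - 1 - 2 * int k) 1)"

definition inversions :: "nat \<Rightarrow> (nat \<Rightarrow> nat) \<Rightarrow> nat" where
  "inversions n \<sigma> = card {(a, b). 1 \<le> a \<and> a < b \<and> b \<le> n \<and> \<sigma> b < \<sigma> a}"

definition conj_lr :: "lring \<Rightarrow> lring" where
  "conj_lr c = (\<Sum>k \<in> Poly_Mapping.keys c. Poly_Mapping.single (- k) (Poly_Mapping.lookup c k))"

definition smul :: "lring \<Rightarrow> ('d \<Rightarrow>\<^sub>0 lring) \<Rightarrow> ('d \<Rightarrow>\<^sub>0 lring)" where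
  "smul c x = (\<Sum>d \<in> Poly_Mapping.keys x. Poly_Mapping.single d (c * Poly_Mapping.lookup x d))"

definition lin_ext :: "('d \<Rightarrow> 'e) \<Rightarrow> ('d \<Rightarrow>\<^sub>0 lring) \<Rightarrow> ('e \<Rightarrow>\<^sub>0 lring)" where
  "lin_ext F x = (\<Sum>d \<in> Poly_Mapping.keys x. Poly_Mapping.single (F d) (Poly_Mapping.lookup x d))"

inductive_set lspan :: "('d \<Rightarrow>\<^sub>0 lring) set \<Rightarrow> ('d \<Rightarrow>\<^sub>0 lring) set" for G where
  zero: "0 \<in> lspan G"
| gen: "x \<in> G \<Longrightarrow> x \<in> lspan G"
| add: "x \<in> lspan G \<Longrightarrow> y \<in> lspan G \<Longrightarrow> x + y \<in> lspan G"
| smul: "x \<in> lspan G \<Longrightarrow> smul c x \<in> lspan G"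

abbreviation mon :: "'d \<Rightarrow> lring \<Rightarrow> ('d \<Rightarrow>\<^sub>0 lring)" where
  "mon d c \<equiv> Poly_Mapping.single d c"


section \<open>The local relations\<close>

text \<open>Pictures are piecewise linear diagrams in the square \<open>sq\<close>. \<open>strand b ps l\<close> is the polygonal
  strand through the points \<open>ps\<close> with level \<open>l\<close>, reversed if \<open>b\<close> is false.\<close>

definition polyline :: "complex list \<Rightarrow> real \<Rightarrow> complex larc set" where
  "polyline ps l = (\<lambda>(p, q). (linepath p q, l)) ` set (zip ps (tl ps))"

definition strand :: "bool \<Rightarrow> complex list \<Rightarrow> real \<Rightarrow> complex larc set" where
  "strand b ps l = polyline (if b then ps else rev ps) l"

abbreviation unst :: "complex larc set \<Rightarrow> complex dgm" where
  "unst A \<equiv> (A, \<lambda>_. 0)"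

abbreviation UL :: complex where "UL \<equiv> Complex (-1) (1/2)"
abbreviation LL :: complex where "LL \<equiv> Complex (-1) (-1/2)"
abbreviation UR :: complex where "UR \<equiv> Complex 1 (1/2)"
abbreviation LR :: complex where "LR \<equiv> Complex 1 (-1/2)"

definition heights_ok :: "nat \<Rightarrow> (nat \<Rightarrow> real) \<Rightarrow> bool" where
  "heights_ok n y \<longleftrightarrow> (\<forall>a \<in> {1..n}. \<bar>y a\<bar> < 1) \<and> (\<forall>a b. 1 \<le> a \<and> a < b \<and> b \<le> n \<longrightarrow> y b < y a)"

text \<open>The framed Reidemeister moves: two strands, three strands, and a strand passing over or
  under a vertex. (Cancellation of opposite kinks follows from \<open>rel_kink\<close>.)\<close>

definition reidemeister :: "nat \<Rightarrow> (complex dgm \<Rightarrow>\<^sub>0 lring) set" where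
  "reidemeister n =
    {mon (unst (strand b [UL, Complex 0 (-1/2), UR] l \<union> strand c [LL, Complex 0 (1/2), LR] m)) 1
       - mon (unst (strand b [UL, UR] l \<union> strand c [LL, LR] m)) 1 | b c l m. l \<noteq> m} \<union>
    {mon (unst (strand b [UL, LR] l \<union> strand c [LL, UR] m
          \<union> strand d [-1, Complex 0 (1/2), 1] k)) 1
       - mon (unst (strand b [UL, LR] l \<union> strand c [LL, UR] m
          \<union> strand d [-1, Complex 0 (-1/2), 1] k)) 1
       | b c d l m k. l \<noteq> m \<and> m \<noteq> k \<and> l \<noteq> k} \<union>
    {mon (unst ((\<Union>a \<in> {1..n}. strand b [Complex (-1) (y a), 0] 0)
          \<union> strand c [Complex (-1/2) 1, Complex (-1/2) (-1)] l)) 1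
       - mon (unst ((\<Union>a \<in> {1..n}. strand b [Complex (-1) (y a), 0] 0)
          \<union> strand c [Complex (-1/2) 1, Complex (1/2) (1/2), Complex (1/2) (-1/2),
                       Complex (-1/2) (-1)] l)) 1
       | b c y l. heights_ok n y \<and> l \<noteq> 0}"

definition rel_cross :: "nat \<Rightarrow> complex dgm \<Rightarrow>\<^sub>0 lring" where
  "rel_cross n =
     mon (unst (strand True [UL, LR] 1 \<union> strand True [LL, UR] 0)) (qp n (-1) (int n))
     - mon (unst (strand True [UL, LR] 0 \<union> strand True [LL, UR] 1)) (qp n 1 (int n))
     - mon (unst (strand True [UL, UR] 0 \<union> strand True [LL, LR] 0)) (qp n (-1) 1 - qp n 1 1)"

text \<open>Both curls with a positive crossing, the loop lying above or below the strand.\<close>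

definition rel_kink :: "nat \<Rightarrow> (complex dgm \<Rightarrow>\<^sub>0 lring) set" where
  "rel_kink n =
    {mon (unst (strand True [-1, Complex (1/2) (1/2), Complex (-1/2) (1/2)] 0
          \<union> strand True [Complex (-1/2) (1/2), 1] 1)) 1 - mon (unst (strand True [-1, 1] 0)) (tt n),
     mon (unst (strand True [-1, Complex (1/2) (-1/2)] 1
          \<union> strand True [Complex (1/2) (-1/2), Complex (-1/2) (-1/2), 1] 0)) 1
       - mon (unst (strand True [-1, 1] 0)) (tt n)}"

definition rel_loop :: "nat \<Rightarrow> (complex dgm \<Rightarrow>\<^sub>0 lring) set" where
  "rel_loop n =
    {mon (unst (strand b [Complex (-1/2) (-1/2), Complex (1/2) (-1/2), Complex 0 (1/2),
                          Complex (-1/2) (-1/2)] 0)) 1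
       - mon (unst {}) ((-1) ^ (n - 1) * qint n) | b. True}"

text \<open>In \<open>rel_vertices\<close> the strand starting at the \<open>a\<close>-th position from the top has level
  \<open>y a\<close>, so at each crossing the strand from the upper left is over; the straight strands of a
  permutation cross pairwise at most once.\<close>

definition rel_vertices :: "nat \<Rightarrow> (complex dgm \<Rightarrow>\<^sub>0 lring) set" where
  "rel_vertices n =
    {mon (unst (\<Union>a \<in> {1..n}. strand True [Complex (-1) (y a), Complex (-1/2) 0] 0
                \<union> strand True [Complex (1/2) 0, Complex 1 (w a)] 0)) 1
       - smul (mq n (- (int n * (int n - 1) div 2)))
           (\<Sum>\<sigma> \<in> {\<sigma>. \<sigma> permutes {1..n}}.
              mon (unst (\<Union>a \<in> {1..n}. strand True [Complex (-1) (y a), Complex 1 (w (\<sigma> a))] (y a)))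
                ((- qp n (int n - 1) (int n)) ^ inversions n \<sigma>))
       | y w. heights_ok n y \<and> heights_ok n w}"

definition rel_int :: "nat \<Rightarrow> (complex dgm \<Rightarrow>\<^sub>0 lring) set" where
  "rel_int n = reidemeister n \<union> {rel_cross n} \<union> rel_kink n \<union> rel_loop n \<union> rel_vertices n"

text \<open>Boundary pictures: the right side of \<open>sq\<close> lies on a boundary edge, whose positive orientation
  is upwards. In \<open>rel_bdry\<close> the levels of the endpoints are \<open>1, 2, \<dots>\<close> from top to bottom.\<close>

definition st2 :: "nat \<Rightarrow> nat \<Rightarrow> complex \<Rightarrow> nat" where
  "st2 i j = (\<lambda>z. if 0 < Im z then i else j)"

definition bar :: "nat \<Rightarrow> nat \<Rightarrow> nat" where
  "bar n i = n + 1 - i"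

definition rel_bvertex :: "nat \<Rightarrow> (complex dgm \<Rightarrow>\<^sub>0 lring) set" where
  "rel_bvertex n =
    {mon (unst (\<Union>a \<in> {1..n}. strand b [Complex (-1) (y a), 0] 0)) 1
       - smul (aa n) (\<Sum>\<sigma> \<in> {\<sigma>. \<sigma> permutes {1..n}}.
           mon (\<Union>a \<in> {1..n}. strand b [Complex (-1) (y a), Complex 1 (y a)] (real a),
                \<lambda>z. \<sigma> (n + 1 - (THE a. a \<in> {1..n} \<and> Im z = y a)))
             (mq n (- int (inversions n \<sigma>))))
       | b y. heights_ok n y}"

definition rel_cap :: "nat \<Rightarrow> (complex dgm \<Rightarrow>\<^sub>0 lring) set" where
  "rel_cap n =
    {mon (strand b [UR, 0] 1 \<union> strand b [0, LR] 2, st2 i j) 1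
       - mon (unst {}) (if bar n j = i then cc n i else 0)
       | b i j. i \<in> {1..n} \<and> j \<in> {1..n}}"

definition rel_turn :: "nat \<Rightarrow> (complex dgm \<Rightarrow>\<^sub>0 lring) set" where
  "rel_turn n =
    {mon (unst (strand b [UL, 0, LL] 0)) 1
       - (\<Sum>i \<in> {1..n}. mon (strand b [UL, UR] 1 \<union> strand b [LR, LL] 2, st2 i (bar n i))
                             (cc_inv n (bar n i)))
       | b. True}"

definition rel_bcross :: "nat \<Rightarrow> (complex dgm \<Rightarrow>\<^sub>0 lring) set" where
  "rel_bcross n =
    {mon (strand b [UL, LR] 2 \<union> strand b [LL, UR] 1, st2 i j) 1
       - smul (qp n 1 (int n))
           (mon (strand b [UL, UR] 1 \<union> strand b [LL, LR] 2, st2 i j)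
              (if j < i then qp n (-1) 1 - qp n 1 1 else 0)
            + mon (strand b [UL, UR] 1 \<union> strand b [LL, LR] 2, st2 j i)
              (if i = j then qp n (-1) 1 else 1))
       | b i j. i \<in> {1..n} \<and> j \<in> {1..n}}"

definition rel_bdry :: "nat \<Rightarrow> (complex dgm \<Rightarrow>\<^sub>0 lring) set" where
  "rel_bdry n = rel_bvertex n \<union> rel_cap n \<union> rel_turn n \<union> rel_bcross n"

text \<open>Isotopy moving two endpoints of different heights past each other along the boundary edge.\<close>

definition rel_swap :: "nat \<Rightarrow> (complex dgm \<Rightarrow>\<^sub>0 lring) set" where
  "rel_swap n =
    {mon (strand b [UL, LR] l \<union> strand c [LL, UR] m, st2 j i) 1
       - mon (strand b [UL, UR] l \<union> strand c [LL, LR] m, st2 i j) 1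
       | b c l m i j. l \<noteq> m \<and> i \<in> {1..n} \<and> j \<in> {1..n}}"

text \<open>\<open>place \<phi> R st T\<close> is the diagram consisting of the arcs \<open>R\<close> outside and of the image of the
  picture \<open>T\<close> inside the embedded square.\<close>

definition place ::
    "(complex \<Rightarrow> 'a) \<Rightarrow> 'a larc set \<Rightarrow> ('a \<Rightarrow> nat) \<Rightarrow> complex dgm \<Rightarrow> 'a dgm" where
  "place \<phi> R st = (\<lambda>(T, s). (R \<union> (\<lambda>(g, l). (\<phi> \<circ> g, l)) ` T,
     \<lambda>x. if x \<in> \<phi> ` {z \<in> sq. Re z = 1 \<and> \<bar>Im z\<bar> < 1} then s (inv_into sq \<phi> x) else st x))"

definition placeable ::
    "nat \<Rightarrow> ('a, 'm) osurf_scheme \<Rightarrow> (complex \<Rightarrow> 'a) \<Rightarrow> 'a larc set \<Rightarrow> ('a \<Rightarrow> nat) \<Rightarrow>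
     (complex dgm \<Rightarrow>\<^sub>0 lring) \<Rightarrow> bool" where
  "placeable n \<Sigma> \<phi> R st \<rho> \<longleftrightarrow> oriented_embedding \<Sigma> sq \<phi> \<and>
     (\<forall>a \<in> R. arc_trace a \<inter> \<phi> ` sq \<subseteq> \<phi> ` frontier sq) \<and>
     (\<forall>T \<in> Poly_Mapping.keys \<rho>. is_diagram n \<Sigma> (place \<phi> R st T))"

definition bdry_square :: "('a, 'm) osurf_scheme \<Rightarrow> (complex \<Rightarrow> 'a) \<Rightarrow> bool" where
  "bdry_square \<Sigma> \<phi> \<longleftrightarrow> \<phi> ` {z \<in> sq. Re z = 1} \<subseteq> bdry \<Sigma> \<and> \<phi> ` {z \<in> sq. Re z < 1} \<subseteq> intr \<Sigma>"

text \<open>The last clause of the set of boundary relations says that the endpoints in the square are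
  consecutive in height.\<close>

definition skein_rels :: "nat \<Rightarrow> ('a, 'm) osurf_scheme \<Rightarrow> ('a dgm \<Rightarrow>\<^sub>0 lring) set" where
  "skein_rels n \<Sigma> =
     {mon D 1 - mon D' 1 | D D'. isotopic_dgm n \<Sigma> D D' \<or> subdivision n \<Sigma> D D'} \<union>
     {lin_ext (place \<phi> R st) \<rho> | \<phi> R st \<rho>.
        \<rho> \<in> rel_int n \<and> placeable n \<Sigma> \<phi> R st \<rho> \<and> \<phi> ` sq \<subseteq> intr \<Sigma>} \<union>
     {lin_ext (place \<phi> R st) \<rho> | \<phi> R st \<rho>.
        \<rho> \<in> rel_swap n \<and> placeable n \<Sigma> \<phi> R st \<rho> \<and> bdry_square \<Sigma> \<phi>} \<union>
     {lin_ext (place \<phi> R st) \<rho> | \<phi> R st \<rho>.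
        \<rho> \<in> rel_bdry n \<and> placeable n \<Sigma> \<phi> R st \<rho> \<and> bdry_square \<Sigma> \<phi> \<and>
        (\<forall>a \<in> R. \<forall>x \<in> arc_ends a. same_bedge \<Sigma> x (\<phi> 1) \<longrightarrow> snd a < 1 \<or> real n + 2 < snd a)}"


section \<open>Stated skein algebras\<close>

definition dmod :: "nat \<Rightarrow> ('a, 'm) osurf_scheme \<Rightarrow> ('a dgm \<Rightarrow>\<^sub>0 lring) set" where
  "dmod n \<Sigma> = {x. \<forall>D \<in> Poly_Mapping.keys x. is_diagram n \<Sigma> D}"

text \<open>\<open>stacks n \<Sigma> D D' E\<close>: \<open>E\<close> is the union of the diagrams \<open>D\<close> and \<open>D'\<close>, with \<open>D\<close> entirely above
  \<open>D'\<close>. Any two diagrams become stackable after an isotopy.\<close>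

definition stacks :: "nat \<Rightarrow> ('a, 'm) osurf_scheme \<Rightarrow> 'a dgm \<Rightarrow> 'a dgm \<Rightarrow> 'a dgm \<Rightarrow> bool" where
  "stacks n \<Sigma> D D' E \<longleftrightarrow> is_diagram n \<Sigma> D \<and> is_diagram n \<Sigma> D' \<and> is_diagram n \<Sigma> E \<and>
     fst E = fst D \<union> fst D' \<and> (\<forall>a \<in> fst D. \<forall>b \<in> fst D'. snd b < snd a) \<and>
     (\<forall>x \<in> \<Union> (arc_ends ` fst D) \<inter> bdry \<Sigma>. snd E x = snd D x) \<and>
     (\<forall>x \<in> \<Union> (arc_ends ` fst D') \<inter> bdry \<Sigma>. snd E x = snd D' x)"

definition dgm_mult :: "nat \<Rightarrow> ('a, 'm) osurf_scheme \<Rightarrow> 'a dgm \<Rightarrow> 'a dgm \<Rightarrow> 'a dgm" where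
  "dgm_mult n \<Sigma> D D' =
     (SOME E. \<exists>D1 D2. isotopic_dgm n \<Sigma> D D1 \<and> isotopic_dgm n \<Sigma> D' D2 \<and> stacks n \<Sigma> D1 D2 E)"

definition dmult ::
    "nat \<Rightarrow> ('a, 'm) osurf_scheme \<Rightarrow> ('a dgm \<Rightarrow>\<^sub>0 lring) \<Rightarrow> ('a dgm \<Rightarrow>\<^sub>0 lring) \<Rightarrow> ('a dgm \<Rightarrow>\<^sub>0 lring)" where
  "dmult n \<Sigma> x y = (\<Sum>D \<in> Poly_Mapping.keys x. \<Sum>D' \<in> Poly_Mapping.keys y.
     mon (dgm_mult n \<Sigma> D D') (Poly_Mapping.lookup x D * Poly_Mapping.lookup y D'))"

definition dcos ::
    "nat \<Rightarrow> ('a, 'm) osurf_scheme \<Rightarrow> ('a dgm \<Rightarrow>\<^sub>0 lring) set \<Rightarrow> ('a dgm \<Rightarrow>\<^sub>0 lring) \<Rightarrow> ('a dgm \<Rightarrow>\<^sub>0 lring) set" where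
  "dcos n \<Sigma> N x = {y \<in> dmod n \<Sigma>. y - x \<in> N}"

definition dquot ::
    "nat \<Rightarrow> ('a, 'm) osurf_scheme \<Rightarrow> ('a dgm \<Rightarrow>\<^sub>0 lring) set \<Rightarrow> ('a dgm \<Rightarrow>\<^sub>0 lring) set ring" where
  "dquot n \<Sigma> N = \<lparr> carrier = dcos n \<Sigma> N ` dmod n \<Sigma>,
     monoid.mult = (\<lambda>X Y. \<Union>x \<in> X. \<Union>y \<in> Y. dcos n \<Sigma> N (dmult n \<Sigma> x y)),
     one = dcos n \<Sigma> N (mon ({}, \<lambda>_. 1) 1),
     zero = dcos n \<Sigma> N 0,
     add = (\<lambda>X Y. \<Union>x \<in> X. \<Union>y \<in> Y. dcos n \<Sigma> N (x + y)) \<rparr>"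

definition dscale ::
    "nat \<Rightarrow> ('a, 'm) osurf_scheme \<Rightarrow> ('a dgm \<Rightarrow>\<^sub>0 lring) set \<Rightarrow> lring \<Rightarrow>
     ('a dgm \<Rightarrow>\<^sub>0 lring) set \<Rightarrow> ('a dgm \<Rightarrow>\<^sub>0 lring) set" where
  "dscale n \<Sigma> N c X = (\<Union>x \<in> X. dcos n \<Sigma> N (smul c x))"

text \<open>A corner arc around a boundary puncture runs along the outer circle of a properly embedded
  punctured half disc. The boundary edge starting at the puncture is on the side of \<open>\<phi> 1\<close>, the one
  ending there on the side of \<open>\<phi> (-1)\<close>.\<close>

definition bad_arc :: "('a, 'm) osurf_scheme \<Rightarrow> 'a larc \<Rightarrow> ('a \<Rightarrow> nat) \<Rightarrow> bool" where
  "bad_arc \<Sigma> a st \<longleftrightarrow> (\<exists>\<phi>. let D = {z. 0 \<le> Im z \<and> 0 < norm z \<and> norm z \<le> 1} in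
     oriented_embedding \<Sigma> D \<phi> \<and> closedin (spc \<Sigma>) (\<phi> ` D) \<and>
     \<phi> ` {z \<in> D. Im z = 0} \<subseteq> bdry \<Sigma> \<and> \<phi> ` {z \<in> D. 0 < Im z} \<subseteq> intr \<Sigma> \<and>
     arc_trace a = \<phi> ` {z \<in> D. norm z = 1} \<and> arc_ends a = {\<phi> 1, \<phi> (-1)} \<and> st (\<phi> 1) < st (\<phi> (-1)))"

definition bad_products :: "nat \<Rightarrow> ('a, 'm) osurf_scheme \<Rightarrow> ('a dgm \<Rightarrow>\<^sub>0 lring) set" where
  "bad_products n \<Sigma> = {mon (A1 \<union> {a} \<union> A2, st) 1 | A1 a A2 st.
     bad_arc \<Sigma> a st \<and> is_diagram n \<Sigma> (A1 \<union> {a} \<union> A2, st) \<and>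
     is_diagram n \<Sigma> (A1, st) \<and> is_diagram n \<Sigma> ({a}, st) \<and> is_diagram n \<Sigma> (A2, st) \<and>
     (\<forall>b \<in> A1. snd a < snd b) \<and> (\<forall>b \<in> A2. snd b < snd a)}"

definition skein_null :: "nat \<Rightarrow> ('a, 'm) osurf_scheme \<Rightarrow> ('a dgm \<Rightarrow>\<^sub>0 lring) set" where
  "skein_null n \<Sigma> = lspan (skein_rels n \<Sigma>)"

definition red_null :: "nat \<Rightarrow> ('a, 'm) osurf_scheme \<Rightarrow> ('a dgm \<Rightarrow>\<^sub>0 lring) set" where
  "red_null n \<Sigma> = lspan (skein_rels n \<Sigma> \<union> bad_products n \<Sigma>)"

definition skein :: "nat \<Rightarrow> ('a, 'm) osurf_scheme \<Rightarrow> ('a dgm \<Rightarrow>\<^sub>0 lring) set ring" where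
  "skein n \<Sigma> = dquot n \<Sigma> (skein_null n \<Sigma>)"

definition red_skein :: "nat \<Rightarrow> ('a, 'm) osurf_scheme \<Rightarrow> ('a dgm \<Rightarrow>\<^sub>0 lring) set ring" where
  "red_skein n \<Sigma> = dquot n \<Sigma> (red_null n \<Sigma>)"

text \<open>Negating the levels switches all crossings and reverses all height orders.\<close>

definition refl_dgm :: "('a dgm \<Rightarrow>\<^sub>0 lring) \<Rightarrow> ('a dgm \<Rightarrow>\<^sub>0 lring)" where
  "refl_dgm x = (\<Sum>D \<in> Poly_Mapping.keys x.
     mon ((\<lambda>(g, l). (g, - l)) ` fst D, snd D) (conj_lr (Poly_Mapping.lookup x D)))"


section \<open>The elements attached to small vertices\<close>

text \<open>Corners of triangles are pairs \<open>(t, r)\<close>. Leaving \<open>t\<close> through side \<open>r\<close> and turning left means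
  circling vertex \<open>r\<close> counterclockwise; \<open>corner_step\<close> is the passage to the next corner.\<close>

definition corner_step :: "'t gluing \<Rightarrow> (('t \<times> nat) \<times> ('t \<times> nat)) set" where
  "corner_step gl = {((t, r), (t', nxt r')) | t r t' r'. ((t, r), (t', r')) \<in> gl}"

text \<open>The \<open>a\<close>-th edge of the bunch leaving the face \<open>t0\<close> through side \<open>r\<close> goes straight from the
  barycentre to the point of the side with barycentric coordinate \<open>s r a\<close> at vertex \<open>r\<close>, and then
  keeps this coordinate constant in every corner it passes (larger coordinate means closer to the
  puncture). Its level \<open>- s r a\<close> increases along the negative boundary orientation.\<close>

definition web_arcs ::
    "'t gluing \<Rightarrow> 't \<Rightarrow> svert \<Rightarrow> (nat \<Rightarrow> nat \<Rightarrow> real) \<Rightarrow> ('t \<times> complex) set larc set" where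
  "web_arcs gl t0 x s = (\<Union>r \<in> {1, 2, 3}. \<Union>a \<in> {..<co r x}.
     insert (pcls gl t0 \<circ> linepath ((crn 1 + crn 2 + crn 3) / 3) (epnt r (s r a)), - s r a)
       {(pcls gl t \<circ> linepath (epnt (nxt (nxt c)) (1 - s r a)) (epnt c (s r a)), - s r a) | t c.
          ((t0, r), (t, c)) \<in> (corner_step gl)\<^sup>+})"

definition is_gweb ::
    "nat \<Rightarrow> 't set \<Rightarrow> 't gluing \<Rightarrow> 't \<Rightarrow> svert \<Rightarrow> ('t \<times> complex) set dgm \<Rightarrow> bool" where
  "is_gweb n T gl t0 x D \<longleftrightarrow> is_diagram n (glued T gl) D \<and> crossings (fst D) = {} \<and>
     (\<exists>s. fst D = web_arcs gl t0 x s \<and>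
        (\<forall>r \<in> {1, 2, 3}. \<forall>a < co r x. 1 / 2 < s r a \<and> s r a < 1 \<and> (\<forall>b < a. s r a < s r b)) \<and>
        (\<forall>r \<in> {1, 2, 3}. \<forall>a < co r x. \<forall>t c.
           ((t0, r), (t, c)) \<in> (corner_step gl)\<^sup>* \<and> (t, c) \<notin> Domain gl
           \<longrightarrow> snd D (pcls gl t (epnt c (s r a))) = n - a))"

definition gbar ::
    "nat \<Rightarrow> 't set \<Rightarrow> 't gluing \<Rightarrow> 't \<Rightarrow> svert \<Rightarrow> (('t \<times> complex) set dgm \<Rightarrow>\<^sub>0 lring) set" where
  "gbar n T gl t0 x = (SOME g. \<exists>D k. is_gweb n T gl t0 x D \<and>
     (let y = mon D ((-1) ^ (n * (n - 1) div 2)) in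
        refl_dgm y - smul (om (2 * k)) y \<in> skein_null n (glued T gl) \<and>
        g = dcos n (glued T gl) (red_null n (glued T gl)) (smul (om k) y)))"


section \<open>Quantum seeds and quantum cluster algebras\<close>

text \<open>The ambient skew field is a type of class \<open>division_ring\<close>, an algebra over the coefficient
  ring via a central element \<open>h\<close>, the image of the square root of \<open>\<omega>\<close>. Vectors indexed by the
  vertices are functions into the integers vanishing off \<open>verts\<close>.\<close>

definition ev :: "'k::division_ring \<Rightarrow> lring \<Rightarrow> 'k" where
  "ev h c = (\<Sum>k \<in> Poly_Mapping.keys c. of_int (Poly_Mapping.lookup c k) * h powi k)"

record ('v, 'k) qseed =
  verts :: "'v set"
  muts :: "'v set"
  Qm :: "'v \<Rightarrow> 'v \<Rightarrow> rat"
  Pm :: "'v \<Rightarrow> 'v \<Rightarrow> int"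
  Mm :: "('v \<Rightarrow> int) \<Rightarrow> 'k"

definition vecs :: "'v set \<Rightarrow> ('v \<Rightarrow> int) set" where
  "vecs V = {a. \<forall>v. v \<notin> V \<longrightarrow> a v = 0}"

definition unitv :: "'v \<Rightarrow> 'v \<Rightarrow> int" where
  "unitv v = (\<lambda>u. if u = v then 1 else 0)"

definition qtorus :: "'k::division_ring \<Rightarrow> ('v, 'k) qseed \<Rightarrow> 'k set" where
  "qtorus h s = {\<Sum>a \<in> K. ev h (c a) * Mm s a | K c. finite K \<and> K \<subseteq> vecs (verts s)}"

text \<open>The last two conditions say that the monomials span a quantum torus whose skew field of
  fractions is the ambient skew field. The square root of \<open>\<xi>\<close> is \<open>h ^ n\<close>.\<close>

definition quantum_seed :: "nat \<Rightarrow> 'k::division_ring \<Rightarrow> ('v, 'k) qseed \<Rightarrow> bool" where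
  "quantum_seed n h s \<longleftrightarrow>
     h \<noteq> 0 \<and> (\<forall>x. h * x = x * h) \<and>
     finite (verts s) \<and> muts s \<subseteq> verts s \<and>
     (\<forall>u \<in> verts s. \<forall>v \<in> verts s. Qm s u v = - Qm s v u \<and> 2 * Qm s u v \<in> \<int> \<and>
        (v \<in> muts s \<longrightarrow> Qm s u v \<in> \<int>)) \<and>
     (\<forall>u \<in> verts s. \<forall>v \<in> verts s. Pm s u v = - Pm s v u) \<and>
     (\<exists>d. \<forall>u \<in> muts s. d u > 0 \<and> (\<forall>v \<in> verts s.
        (\<Sum>k \<in> verts s. Qm s k u * of_int (Pm s k v)) = (if u = v then d u else 0))) \<and>
     (\<forall>a \<in> vecs (verts s). \<forall>b \<in> vecs (verts s).
        Mm s a * Mm s b =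
          h powi (int n * (\<Sum>u \<in> verts s. \<Sum>v \<in> verts s. a u * Pm s u v * b v)) * Mm s (\<lambda>v. a v + b v)) \<and>
     (\<forall>K c. finite K \<and> K \<subseteq> vecs (verts s) \<and> (\<Sum>a \<in> K. ev h (c a) * Mm s a) = 0 \<longrightarrow> (\<forall>a \<in> K. c a = 0)) \<and>
     (\<forall>x. \<exists>a \<in> qtorus h s. \<exists>b \<in> qtorus h s. b \<noteq> 0 \<and> x = a * inverse b)"

definition mut_matrix :: "'v \<Rightarrow> ('v \<Rightarrow> 'v \<Rightarrow> rat) \<Rightarrow> 'v \<Rightarrow> 'v \<Rightarrow> rat" where
  "mut_matrix k Q i j = (if i = k \<or> j = k then - Q i j
     else Q i j + (\<bar>Q i k\<bar> * Q k j + Q i k * \<bar>Q k j\<bar>) / 2)"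

definition exch_vec :: "('v, 'k) qseed \<Rightarrow> 'v \<Rightarrow> rat \<Rightarrow> 'v \<Rightarrow> int" where
  "exch_vec s k \<epsilon> = (\<lambda>j. if j \<in> verts s then \<lfloor>max 0 (\<epsilon> * Qm s j k)\<rfloor> - unitv k j else 0)"

text \<open>The mutated seed is determined by these conditions up to the irrelevant values of its
  components outside \<open>verts\<close>: the new cluster variables determine the new commutation matrix
  and the new normalized monomials.\<close>

definition mutates :: "nat \<Rightarrow> 'k::division_ring \<Rightarrow> 'v \<Rightarrow> ('v, 'k) qseed \<Rightarrow> ('v, 'k) qseed \<Rightarrow> bool" where
  "mutates n h k s s' \<longleftrightarrow> k \<in> muts s \<and> quantum_seed n h s' \<and>
     verts s' = verts s \<and> muts s' = muts s \<and>
     (\<forall>i \<in> verts s. \<forall>j \<in> verts s. Qm s' i j = mut_matrix k (Qm s) i j) \<and>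
     (\<forall>v \<in> verts s - {k}. Mm s' (unitv v) = Mm s (unitv v)) \<and>
     Mm s' (unitv k) = Mm s (exch_vec s k 1) + Mm s (exch_vec s k (-1))"

definition mut_equiv :: "nat \<Rightarrow> 'k::division_ring \<Rightarrow> ('v, 'k) qseed \<Rightarrow> ('v, 'k) qseed \<Rightarrow> bool" where
  "mut_equiv n h = (\<lambda>s s'. \<exists>k. mutates n h k s s')\<^sup>*\<^sup>*"

inductive_set alg_gen :: "'k::division_ring \<Rightarrow> 'k set \<Rightarrow> 'k set" for h G where
  gen: "x \<in> G \<Longrightarrow> x \<in> alg_gen h G"
| coeff: "ev h c \<in> alg_gen h G"
| add: "x \<in> alg_gen h G \<Longrightarrow> y \<in> alg_gen h G \<Longrightarrow> x + y \<in> alg_gen h G"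
| mult: "x \<in> alg_gen h G \<Longrightarrow> y \<in> alg_gen h G \<Longrightarrow> x * y \<in> alg_gen h G"

definition cluster_algebra :: "nat \<Rightarrow> 'k::division_ring \<Rightarrow> ('v, 'k) qseed \<Rightarrow> 'k set" where
  "cluster_algebra n h s = alg_gen h
     ({Mm s' (unitv v) | s' v. mut_equiv n h s s' \<and> v \<in> verts s} \<union>
      {inverse (Mm s (unitv v)) | v. v \<in> verts s - muts s})"

definition alg_hom ::
    "'k::division_ring \<Rightarrow> 'k set \<Rightarrow> 'l::division_ring \<Rightarrow> 'l set \<Rightarrow> ('k \<Rightarrow> 'l) \<Rightarrow> bool" where
  "alg_hom h A h' B f \<longleftrightarrow> f ` A \<subseteq> B \<and> (\<forall>c. f (ev h c) = ev h' c) \<and>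
     (\<forall>x \<in> A. \<forall>y \<in> A. f (x + y) = f x + f y \<and> f (x * y) = f x * f y)"

text \<open>In condition (4) the homomorphism is applied to Laurent monomials, i.e. it is extended to the
  localization at the initial cluster variables (such an extension is unique).\<close>

definition cluster_loc :: "nat \<Rightarrow> 'k::division_ring \<Rightarrow> ('v, 'k) qseed \<Rightarrow> 'k set" where
  "cluster_loc n h s =
     alg_gen h (cluster_algebra n h s \<union> {inverse (Mm s (unitv v)) | v. v \<in> verts s})"

definition Qcol :: "('v, 'k) qseed \<Rightarrow> 'v \<Rightarrow> 'v \<Rightarrow> int" where
  "Qcol s v = (\<lambda>u. if u \<in> verts s then \<lfloor>Qm s u v\<rfloor> else 0)"

definition quasi_hom ::
    "nat \<Rightarrow> 'k::division_ring \<Rightarrow> ('v, 'k) qseed \<Rightarrow> 'l::division_ring \<Rightarrow> ('v, 'l) qseed \<Rightarrow>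
     ('k \<Rightarrow> 'l) \<Rightarrow> bool" where
  "quasi_hom n h s h' s' f \<longleftrightarrow>
     quantum_seed n h s \<and> quantum_seed n h' s' \<and> muts s = muts s' \<and>
     alg_hom h (cluster_algebra n h s) h' (cluster_algebra n h' s') f \<and>
     (\<forall>u \<in> muts s. \<forall>v \<in> muts s. Qm s u v = Qm s' u v) \<and>
     (\<forall>v \<in> muts s. \<exists>w \<in> vecs (verts s'). f (Mm s (unitv v)) = Mm s' w \<and>
        w v = 1 \<and> (\<forall>u \<in> muts s - {v}. w u = 0)) \<and>
     (\<forall>v \<in> verts s - muts s. \<exists>w \<in> vecs (verts s'). f (Mm s (unitv v)) = Mm s' w \<and>
        (\<forall>u \<in> muts s. w u = 0)) \<and>
     (\<exists>g. alg_hom h (cluster_loc n h s) h' UNIV g \<and> (\<forall>x \<in> cluster_algebra n h s. g x = f x) \<and>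
        (\<forall>v \<in> muts s. g (Mm s (Qcol s v)) = Mm s' (Qcol s' v)))"

definition quasi_iso ::
    "nat \<Rightarrow> 'k::division_ring \<Rightarrow> ('v, 'k) qseed \<Rightarrow> 'l::division_ring \<Rightarrow> ('v, 'l) qseed \<Rightarrow>
     ('k \<Rightarrow> 'l) \<Rightarrow> bool" where
  "quasi_iso n h s h' s' f \<longleftrightarrow> quasi_hom n h s h' s' f \<and>
     bij_betw f (cluster_algebra n h s) (cluster_algebra n h' s')"


section \<open>The two seeds of the extended surface\<close>

definition whole_ring :: "'k::division_ring ring" where
  "whole_ring = \<lparr> carrier = UNIV, monoid.mult = (*), one = 1, zero = 0, add = (+) \<rparr>"

text \<open>\<open>is_seed_bar n T gl h tr s\<close>: \<open>s\<close> is the quantum seed of the reduced stated skein algebra of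
  the triangulated surface, where \<open>tr\<close> is the algebra map to the quantum torus taking the element of
  every small vertex to the corresponding cluster variable. The ambient skew field is that of
  fractions of the image of \<open>tr\<close>. This collects the known facts that the elements quasi-commute,
  that \<open>tr\<close> exists, and that the exchange and commutation matrices are compatible.\<close>

definition is_seed_bar ::
    "nat \<Rightarrow> 't set \<Rightarrow> 't gluing \<Rightarrow> 'k::division_ring \<Rightarrow>
     ((('t \<times> complex) set dgm \<Rightarrow>\<^sub>0 lring) set \<Rightarrow> 'k) \<Rightarrow> ('t vert, 'k) qseed \<Rightarrow> bool" where
  "is_seed_bar n T gl h tr s \<longleftrightarrow>
     (let \<Sigma> = glued T gl; N = red_null n \<Sigma>; A = red_skein n \<Sigma> in
       verts s = Vbar n T gl \<and> muts s = Vmut n T gl \<and>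
       (\<forall>v \<in> verts s. \<forall>w \<in> verts s. Qm s v w = Qbar v w) \<and>
       (\<forall>v \<in> verts s. \<forall>w \<in> verts s. \<forall>(t, x) \<in> v. \<forall>(t', x') \<in> w.
          gbar n T gl t x \<otimes>\<^bsub>A\<^esub> gbar n T gl t' x' =
            dscale n \<Sigma> N (om (2 * int n * Pm s v w)) (gbar n T gl t' x' \<otimes>\<^bsub>A\<^esub> gbar n T gl t x)) \<and>
       quantum_seed n h s \<and>
       tr \<in> ring_hom A whole_ring \<and>
       (\<forall>c. \<forall>X \<in> carrier A. tr (dscale n \<Sigma> N c X) = ev h c * tr X) \<and>
       tr ` carrier A \<subseteq> qtorus h s \<and>
       (\<forall>v \<in> verts s. \<forall>(t, x) \<in> v. tr (gbar n T gl t x) = Mm s (unitv v)) \<and>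
       (\<forall>y. \<exists>X \<in> carrier A. \<exists>Y \<in> carrier A. tr Y \<noteq> 0 \<and> y = tr X * inverse (tr Y)))"

definition Vlam :: "nat \<Rightarrow> ('f, 'b) tri set \<Rightarrow> ('f, 'b) tri gluing \<Rightarrow> ('f, 'b) tri vert set" where
  "Vlam n T gl = {v \<in> Vbar n T gl. \<exists>(t, x) \<in> v. case t of Core f \<Rightarrow> True | Att b \<Rightarrow> co 3 x = 0}"

text \<open>The second side of a triangle is the one on which the first coordinate vanishes.\<close>

definition Vprime :: "nat \<Rightarrow> ('f, 'b) tri set \<Rightarrow> ('f, 'b) tri gluing \<Rightarrow> ('f, 'b) tri vert set" where
  "Vprime n T gl = {v \<in> Vbar n T gl. \<not> (\<exists>b x. (Att b, x) \<in> v \<and> co 1 x = 0)}"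

definition pshift :: "nat \<Rightarrow> ('f, 'b) tri gluing \<Rightarrow> ('f, 'b) tri vert \<Rightarrow> ('f, 'b) tri vert" where
  "pshift n gl v = (THE w. \<exists>b i j k. (Att b, (i, j, k)) \<in> v \<and> k \<noteq> 0 \<and>
     w = vcls n gl (Att b) (0, n - k, k))"

text \<open>Exponent vector of the Laurent monomial \<open>A\<^sub>v\<close> of the second seed in the variables of the
  first one.\<close>

definition qc_vec ::
    "nat \<Rightarrow> ('f, 'b) tri set \<Rightarrow> ('f, 'b) tri gluing \<Rightarrow> ('f, 'b) tri vert \<Rightarrow> ('f, 'b) tri vert \<Rightarrow> int" where
  "qc_vec n T gl v = (if v \<in> Vprime n T gl - Vlam n T gl
     then (\<lambda>u. unitv v u - unitv (pshift n gl v) u) else unitv v)"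

definition seed_qc ::
    "nat \<Rightarrow> ('f, 'b) tri set \<Rightarrow> ('f, 'b) tri gluing \<Rightarrow> (('f, 'b) tri vert, 'k) qseed \<Rightarrow>
     (('f, 'b) tri vert, 'k) qseed" where
  "seed_qc n T gl s = \<lparr> verts = verts s, muts = muts s,
     Qm = (\<lambda>v w. if v \<in> Vprime n T gl \<and> w \<in> Vprime n T gl then Qm s v w else 0),
     Pm = (\<lambda>v w. \<Sum>a \<in> verts s. \<Sum>b \<in> verts s. qc_vec n T gl v a * Pm s a b * qc_vec n T gl w b),
     Mm = (\<lambda>c. Mm s (\<lambda>u. \<Sum>v \<in> verts s. c v * qc_vec n T gl v u)) \<rparr>"

end

theory Submission
  imports Defs
begin

text \<open>The two seeds live in the same skew field, and the quasi-isomorphism is the identity map: the two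
  cluster algebras coincide as subrings. Call a seed \<open>s'\<close> a twist of \<open>s\<close> if its monomials are those
  of \<open>s\<close> reparametrized by a linear automorphism of the exponent lattice which does not change the
  mutable coordinates and carries the mutable columns of the exchange matrix of \<open>s'\<close> to those of \<open>s\<close>.
  Then corresponding cluster variables differ by frozen monomials, and mutating \<open>s\<close> and \<open>s'\<close> at the
  same vertex gives twisted seeds again. That the seed of the proposition is a twist of the first
  one amounts to a cancellation: in an attached triangle the arrows between a mutable vertex and the
  points of a line \<open>k = const \<noteq> 0\<close> add up to zero.\<close>

section \<open>Integer vectors\<close>

text \<open>The cancellation comes from comparing exponents. In the matrix of the second seed the
  entry at a frozen vertex u = (0, n - k, k) has been deleted. The twist subtracts at u every entry
  of the column at the points (i, n - k - i, k) with i > 0, since their variables are divided by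
  that of u. The result must be the original entry at u, so what is required is that the original
  column sums to zero over the whole line, u included. A second difficulty is that a mutation is
  specified by its cluster variables alone. Commutation exponents and normalized monomials of the
  new seed are therefore recovered from products in the skew field, which works because
  \<open>h\<close> is not a root of unity.\<close>

lemma vecs_zero [simp]: "(\<lambda>_. 0) \<in> vecs V"
  by (simp add: vecs_def)

lemma vecs_add: "a \<in> vecs V \<Longrightarrow> b \<in> vecs V \<Longrightarrow> (\<lambda>v. a v + b v) \<in> vecs V"
  by (simp add: vecs_def)

lemma vecs_diff: "a \<in> vecs V \<Longrightarrow> b \<in> vecs V \<Longrightarrow> (\<lambda>v. a v - b v) \<in> vecs V"
  by (simp add: vecs_def)

lemma vecs_uminus: "a \<in> vecs V \<Longrightarrow> (\<lambda>v. - a v) \<in> vecs V"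
  by (simp add: vecs_def)

lemma vecs_scale: "a \<in> vecs V \<Longrightarrow> (\<lambda>v. x * a v) \<in> vecs V"
  by (simp add: vecs_def)

lemma unitv_vecs [simp]: "unitv v \<in> vecs V \<longleftrightarrow> v \<in> V"
  by (auto simp: vecs_def unitv_def)

lemma unitv_same [simp]: "unitv v v = 1"
  by (simp add: unitv_def)

lemma unitv_other [simp]: "u \<noteq> v \<Longrightarrow> unitv v u = 0"
  by (simp add: unitv_def)

lemma vecs_mono: "A \<subseteq> B \<Longrightarrow> a \<in> vecs A \<Longrightarrow> a \<in> vecs B"
  by (auto simp: vecs_def)

lemmas vecs_intros = vecs_add vecs_diff vecs_uminus vecs_scale

text \<open>Induction on the sum of the absolute values of the coordinates. The sign conditions say
  that each step leads away from zero. A vector with nonnegative coordinates is therefore reached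
  through such vectors only, which is what the treatment of exchange monomials relies on.\<close>

lemma vecs_induct [consumes 2, case_names zero plus minus]:
  assumes "finite A" and "a \<in> vecs A"
    and zero: "P (\<lambda>_. 0)"
    and plus: "\<And>a u. a \<in> vecs A \<Longrightarrow> u \<in> A \<Longrightarrow> 0 \<le> a u \<Longrightarrow> P a \<Longrightarrow> P (\<lambda>v. a v + unitv u v)"
    and minus: "\<And>a u. a \<in> vecs A \<Longrightarrow> u \<in> A \<Longrightarrow> a u \<le> 0 \<Longrightarrow> P a \<Longrightarrow> P (\<lambda>v. a v - unitv u v)"
  shows "P a"
  using assms(2)
proof (induction "\<Sum>u\<in>A. nat \<bar>a u\<bar>" arbitrary: a rule: less_induct)
  case (less a)
  show ?case
  proof (cases "\<exists>u\<in>A. a u \<noteq> 0")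
    case False
    then have "a = (\<lambda>_. 0)" using less.prems by (auto simp: vecs_def)
    then show ?thesis using zero by simp
  next
    case True
    then obtain u where u: "u \<in> A" "a u \<noteq> 0" by blast
    \<comment> \<open>Here \<epsilon> is 1 or -1, the unit by which the coordinate at
      \<open>u\<close> moves towards zero.\<close>
    have step: "P (\<lambda>v. a v - \<epsilon> * unitv u v)" if "\<bar>a u - \<epsilon>\<bar> < \<bar>a u\<bar>" for \<epsilon>
    proof (rule less.hyps)
      show "(\<lambda>v. a v - \<epsilon> * unitv u v) \<in> vecs A"
        using less.prems u by (intro vecs_intros) auto
      show "(\<Sum>w\<in>A. nat \<bar>a w - \<epsilon> * unitv u w\<bar>) < (\<Sum>w\<in>A. nat \<bar>a w\<bar>)"
      proof (rule sum_strict_mono_ex1)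
        show "\<forall>w\<in>A. nat \<bar>a w - \<epsilon> * unitv u w\<bar> \<le> nat \<bar>a w\<bar>"
          using that by (auto simp: unitv_def)
        show "\<exists>w\<in>A. nat \<bar>a w - \<epsilon> * unitv u w\<bar> < nat \<bar>a w\<bar>"
          using that u by (auto intro!: bexI[of _ u])
      qed (use assms in auto)
    qed
    show ?thesis
    proof (cases "0 < a u")
      case True
      have "P (\<lambda>v. a v - 1 * unitv u v)" using True by (intro step) auto
      moreover have "(\<lambda>v. a v - 1 * unitv u v) \<in> vecs A"
        using less.prems u by (intro vecs_intros) auto
      ultimately have "P (\<lambda>v. (a v - 1 * unitv u v) + unitv u v)"
        using u True by (intro plus) auto
      then show ?thesis by simp
    next
      case False
      have "P (\<lambda>v. a v - (-1) * unitv u v)" using False u by (intro step) auto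
      moreover have "(\<lambda>v. a v - (-1) * unitv u v) \<in> vecs A"
        using less.prems u by (intro vecs_intros) auto
      ultimately have "P (\<lambda>v. (a v - (-1) * unitv u v) - unitv u v)"
        using u False by (intro minus) auto
      then show ?thesis by simp
    qed
  qed
qed


section \<open>Monomials of a quantum seed\<close>

definition bform :: "('v, 'k) qseed \<Rightarrow> ('v \<Rightarrow> int) \<Rightarrow> ('v \<Rightarrow> int) \<Rightarrow> int" where
  "bform s a b = (\<Sum>u \<in> verts s. \<Sum>v \<in> verts s. a u * Pm s u v * b v)"

lemma bform_diff_left: "bform s (\<lambda>v. a v - b v) c = bform s a c - bform s b c"
  by (simp add: bform_def sum_subtractf algebra_simps)

lemma bform_uminus_right: "bform s a (\<lambda>v. - b v) = - bform s a b"
  by (simp add: bform_def sum_negf)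

lemma quantum_seed_finite: "quantum_seed n h s \<Longrightarrow> finite (verts s)"
  by (simp add: quantum_seed_def)

lemma quantum_seed_muts: "quantum_seed n h s \<Longrightarrow> v \<in> muts s \<Longrightarrow> v \<in> verts s"
  by (auto simp: quantum_seed_def)

lemma quantum_seed_nz: "quantum_seed n h s \<Longrightarrow> h \<noteq> 0"
  by (simp add: quantum_seed_def)

lemma quantum_seed_skew:
  "quantum_seed n h s \<Longrightarrow> u \<in> verts s \<Longrightarrow> v \<in> verts s \<Longrightarrow> Qm s u v = - Qm s v u"
  unfolding quantum_seed_def by (elim conjE) blast

lemma quantum_seed_half_int:
  "quantum_seed n h s \<Longrightarrow> u \<in> verts s \<Longrightarrow> v \<in> verts s \<Longrightarrow> 2 * Qm s u v \<in> \<int>"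
  unfolding quantum_seed_def by (elim conjE) blast

lemma quantum_seed_int:
  "quantum_seed n h s \<Longrightarrow> u \<in> verts s \<Longrightarrow> v \<in> muts s \<Longrightarrow> Qm s u v \<in> \<int>"
  unfolding quantum_seed_def by (elim conjE) blast

lemma quantum_seed_Pm_skew:
  "quantum_seed n h s \<Longrightarrow> u \<in> verts s \<Longrightarrow> v \<in> verts s \<Longrightarrow> Pm s u v = - Pm s v u"
  unfolding quantum_seed_def by (elim conjE) blast

lemma quantum_seed_compat:
  "quantum_seed n h s \<Longrightarrow> \<exists>d. \<forall>u \<in> muts s. d u > 0 \<and> (\<forall>v \<in> verts s.
    (\<Sum>k \<in> verts s. Qm s k u * of_int (Pm s k v)) = (if u = v then d u else 0))"
  unfolding quantum_seed_def by (elim conjE)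

lemma Mm_mult:
  assumes "quantum_seed n h s" "a \<in> vecs (verts s)" "b \<in> vecs (verts s)"
  shows "Mm s a * Mm s b = h powi (int n * bform s a b) * Mm s (\<lambda>v. a v + b v)"
proof -
  have "\<forall>a \<in> vecs (verts s). \<forall>b \<in> vecs (verts s).
      Mm s a * Mm s b = h powi (int n * bform s a b) * Mm s (\<lambda>v. a v + b v)"
    using assms(1) unfolding quantum_seed_def bform_def by (elim conjE)
  then show ?thesis using assms(2,3) by simp
qed

lemma quantum_seed_indep:
  assumes "quantum_seed n h s" "finite K" "K \<subseteq> vecs (verts s)"
    and "(\<Sum>a \<in> K. ev h (c a) * Mm s a) = 0" "a \<in> K"
  shows "c a = 0"
proof -
  have "\<forall>K c. finite K \<and> K \<subseteq> vecs (verts s) \<and> (\<Sum>a \<in> K. ev h (c a) * Mm s a) = 0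
      \<longrightarrow> (\<forall>a \<in> K. c a = 0)"
    using assms(1) unfolding quantum_seed_def by (elim conjE)
  from this[rule_format, OF conjI[OF assms(2) conjI[OF assms(3,4)]] assms(5)] show ?thesis .
qed

lemma ev_superset:
  assumes "finite A" "Poly_Mapping.keys c \<subseteq> A"
  shows "ev h c = (\<Sum>k \<in> A. of_int (Poly_Mapping.lookup c k) * h powi k)"
  unfolding ev_def using assms
  by (intro sum.mono_neutral_left) (auto simp: in_keys_iff)

lemma ev_om [simp]: "ev h (om k) = h powi k"
  by (simp add: ev_def om_def)

lemma ev_one [simp]: "ev h 1 = 1"
  using ev_om[of h 0] by (simp add: om_def)

lemma ev_om_diff: "ev h (om k - om l) = h powi k - h powi l"
proof (cases "k = l")
  case True
  then show ?thesis by (simp add: ev_def)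
next
  case False
  have "Poly_Mapping.keys (om k - om l) \<subseteq> {k, l}"
    by (auto simp: in_keys_iff om_def lookup_minus lookup_single when_def split: if_splits)
  then have "ev h (om k - om l) =
      (\<Sum>i \<in> {k, l}. of_int (Poly_Mapping.lookup (om k - om l) i) * h powi i)"
    by (intro ev_superset) auto
  then show ?thesis using False
    by (simp add: om_def lookup_minus lookup_single when_def)
qed

lemma Mm_nonzero:
  assumes "quantum_seed n h s" "a \<in> vecs (verts s)"
  shows "Mm s a \<noteq> 0"
proof
  assume "Mm s a = 0"
  then have "(\<Sum>a \<in> {a}. ev h 1 * Mm s a) = 0" by simp
  from quantum_seed_indep[OF assms(1) _ _ this] assms(2) show False by auto
qed

lemma Mm_zero:
  assumes "quantum_seed n h s"
  shows "Mm s (\<lambda>_. 0) = 1"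
proof -
  have "Mm s (\<lambda>_. 0) * Mm s (\<lambda>_. 0) = Mm s (\<lambda>_. 0)"
    using Mm_mult[OF assms, of "\<lambda>_. 0" "\<lambda>_. 0"] by (simp add: bform_def)
  then show ?thesis using Mm_nonzero[OF assms, of "\<lambda>_. 0"] by simp
qed

text \<open>Independence of the monomials over the coefficient ring, applied to the single monomial
  1, makes evaluation of coefficients injective.\<close>

lemma powi_inject:
  assumes "quantum_seed n h s" "h powi k = h powi l"
  shows "k = l"
proof -
  have "(\<Sum>a \<in> {\<lambda>_. 0}. ev h (om k - om l) * Mm s a) = 0"
    using assms(2) by (simp add: ev_om_diff)
  then have "om k - om l = 0"
    by (intro quantum_seed_indep[OF assms(1), where K = "{\<lambda>_. 0}" and c = "\<lambda>_. om k - om l"])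
      auto
  then have "Poly_Mapping.lookup (om k - om l) k = 0" by simp
  then show ?thesis by (auto simp: om_def lookup_minus lookup_single when_def split: if_splits)
qed

lemma bform_swap:
  assumes "quantum_seed n h s"
  shows "bform s a b = - bform s b a"
proof -
  have "bform s a b = (\<Sum>v \<in> verts s. \<Sum>u \<in> verts s. a u * Pm s u v * b v)"
    unfolding bform_def by (rule sum.swap)
  also have "\<dots> = (\<Sum>v \<in> verts s. \<Sum>u \<in> verts s. - (b v * Pm s v u * a u))"
  proof (intro sum.cong refl)
    fix u v assume "v \<in> verts s" "u \<in> verts s"
    then show "a u * Pm s u v * b v = - (b v * Pm s v u * a u)"
      using quantum_seed_Pm_skew[OF assms, of u v] by simp
  qed
  finally show ?thesis by (simp add: bform_def sum_negf)
qed

lemma Mm_add: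
  assumes "quantum_seed n h s" "a \<in> vecs (verts s)" "b \<in> vecs (verts s)"
  shows "Mm s (\<lambda>v. a v + b v) = h powi (- (int n * bform s a b)) * (Mm s a * Mm s b)"
  unfolding Mm_mult[OF assms] using quantum_seed_nz[OF assms(1)]
  by (simp add: mult.assoc[symmetric] power_int_add[symmetric])

lemma Mm_uminus:
  assumes "quantum_seed n h s" "a \<in> vecs (verts s)"
  shows "Mm s (\<lambda>v. - a v) = inverse (Mm s a)"
proof -
  have "bform s a a = 0" using bform_swap[OF assms(1), of a a] by simp
  then have "Mm s a * Mm s (\<lambda>v. - a v) = 1"
    using Mm_mult[OF assms(1,2) vecs_uminus[OF assms(2)]] Mm_zero[OF assms(1)]
    by (simp add: bform_uminus_right)
  then show ?thesis by (simp add: inverse_unique)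
qed

lemma Mm_commute:
  assumes "quantum_seed n h s" "a \<in> vecs (verts s)" "b \<in> vecs (verts s)"
  shows "Mm s a * Mm s b = h powi (2 * int n * bform s a b) * (Mm s b * Mm s a)"
proof -
  have "Mm s b * Mm s a = h powi (- (int n * bform s a b)) * Mm s (\<lambda>v. a v + b v)"
    using Mm_mult[OF assms(1,3,2)] bform_swap[OF assms(1), of b a] by (simp add: add.commute)
  moreover have "2 * int n * bform s a b + - (int n * bform s a b) = int n * bform s a b" by simp
  ultimately show ?thesis
    using Mm_mult[OF assms] quantum_seed_nz[OF assms(1)]
    by (simp add: mult.assoc[symmetric] power_int_add[symmetric])
qed

text \<open>Lets an entry of the commutation form be read off from two elements of the skew field.
  This is how the form of a mutated seed is computed, since \<open>mutates\<close> does not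
  prescribe it.\<close>

lemma commutation_exponent_unique:
  assumes "quantum_seed n h s" "n \<ge> 1" "x \<noteq> 0" "y \<noteq> 0"
    and "x * y = h powi (2 * int n * i) * (y * x)" "x * y = h powi (2 * int n * j) * (y * x)"
  shows "i = j"
proof -
  have "h powi (2 * int n * i) = h powi (2 * int n * j)"
    using assms(3-6) by simp
  from powi_inject[OF assms(1) this] show ?thesis using assms(2) by simp
qed

lemma bform_eq_of_Mm_eq:
  assumes "quantum_seed n h s" "quantum_seed n h t" "n \<ge> 1"
    and "a \<in> vecs (verts s)" "b \<in> vecs (verts s)" "c \<in> vecs (verts t)" "d \<in> vecs (verts t)"
    and "Mm s a = Mm t c" "Mm s b = Mm t d"
  shows "bform s a b = bform t c d"
proof (rule commutation_exponent_unique[OF assms(1,3)])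
  show "Mm s a * Mm s b = h powi (2 * int n * bform s a b) * (Mm s b * Mm s a)"
    by (rule Mm_commute[OF assms(1,4,5)])
  show "Mm s a * Mm s b = h powi (2 * int n * bform t c d) * (Mm s b * Mm s a)"
    unfolding assms(8,9) by (rule Mm_commute[OF assms(2,6,7)])
qed (simp_all add: Mm_nonzero[OF assms(1)] assms(4,5))

text \<open>The normalizing power of \<open>h\<close> in a monomial is governed by the commutation
  of its factors, hence by the variables themselves. A mutation at \<open>k\<close> thus keeps all
  monomials without a factor at \<open>k\<close>.\<close>

lemma Mm_eq_on_common_variables:
  assumes "quantum_seed n h s" "quantum_seed n h t" "n \<ge> 1" "verts t = verts s"
    and "A \<subseteq> verts s" "\<And>u. u \<in> A \<Longrightarrow> Mm t (unitv u) = Mm s (unitv u)" and a: "a \<in> vecs A"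
  shows "Mm t a = Mm s a"
proof -
  have fin: "finite A" using assms(5) quantum_seed_finite[OF assms(1)] finite_subset by blast
  have add: "Mm t (\<lambda>v. a v + b v) = Mm s (\<lambda>v. a v + b v)"
    if "a \<in> vecs (verts s)" "b \<in> vecs (verts s)" "Mm t a = Mm s a" "Mm t b = Mm s b" for a b
  proof -
    have "bform t a b = bform s a b"
      using that assms(4) by (intro bform_eq_of_Mm_eq[OF assms(2,1,3)]) auto
    then show ?thesis using that assms(4) by (simp add: Mm_add[OF assms(1)] Mm_add[OF assms(2)])
  qed
  show ?thesis using fin a
  proof (induction rule: vecs_induct)
    case zero
    then show ?case by (simp add: Mm_zero[OF assms(1)] Mm_zero[OF assms(2)])
  next
    case (plus a u)
    then show ?case using assms(5,6) vecs_mono[OF assms(5)] by (intro add) auto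
  next
    case (minus a u)
    have u: "unitv u \<in> vecs (verts s)" using minus assms(5) by auto
    have "Mm t (\<lambda>v. a v + - unitv u v) = Mm s (\<lambda>v. a v + - unitv u v)"
      using minus u assms(4,6) vecs_mono[OF assms(5)]
      by (intro add) (auto simp: Mm_uminus[OF assms(1)] Mm_uminus[OF assms(2)] vecs_uminus)
    then show ?case by simp
  qed
qed

section \<open>Columns of the exchange matrix and the commutation form\<close>

lemma Qcol_vecs [simp]: "Qcol s v \<in> vecs (verts s)"
  by (simp add: Qcol_def vecs_def)

lemma of_int_Qcol:
  assumes "quantum_seed n h s" "u \<in> verts s" "v \<in> muts s"
  shows "of_int (Qcol s v u) = Qm s u v"
  using quantum_seed_int[OF assms] assms(2) by (simp add: Qcol_def)

text \<open>This is the compatibility condition in coordinate-free form: pairing with column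
  \<open>u\<close> extracts coordinate \<open>u\<close>, up to a positive factor. In this form it
  passes to twists, because they preserve mutable coordinates.\<close>

lemma bform_Qcol_ex:
  assumes "quantum_seed n h s"
  shows "\<exists>d. \<forall>u \<in> muts s. d u > 0 \<and>
    (\<forall>b. rat_of_int (bform s (Qcol s u) b) = d u * of_int (b u))"
proof -
  from quantum_seed_compat[OF assms(1)] obtain d where d: "\<forall>u \<in> muts s. d u > 0 \<and>
      (\<forall>v \<in> verts s.
        (\<Sum>k \<in> verts s. Qm s k u * of_int (Pm s k v)) = (if u = v then d u else 0))" ..
  have "of_int (bform s (Qcol s u) b) = d u * of_int (b u)" if u: "u \<in> muts s" for u b
  proof -
    have "bform s (Qcol s u) b = (\<Sum>v \<in> verts s. \<Sum>k \<in> verts s. Qcol s u k * Pm s k v * b v)"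
      unfolding bform_def by (rule sum.swap)
    then have "rat_of_int (bform s (Qcol s u) b) =
        (\<Sum>v \<in> verts s. (\<Sum>k \<in> verts s. Qm s k u * of_int (Pm s k v)) * of_int (b v))"
      by (simp add: sum_distrib_right of_int_Qcol[OF assms(1) _ u])
    also have "\<dots> = (\<Sum>v \<in> verts s. if u = v then d u * of_int (b v) else 0)"
      using d u by (intro sum.cong refl) auto
    also have "\<dots> = d u * of_int (b u)"
      using quantum_seed_finite[OF assms] quantum_seed_muts[OF assms u] by simp
    finally show ?thesis .
  qed
  then show ?thesis using d by (intro exI[of _ d]) auto
qed

lemma bform_Qcol:
  assumes "quantum_seed n h s" "u \<in> muts s" "b u = 0"
  shows "bform s (Qcol s u) b = 0"
proof -
  obtain d where "\<forall>u \<in> muts s. d u > 0 \<and>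
      (\<forall>b. rat_of_int (bform s (Qcol s u) b) = d u * of_int (b u))"
    using bform_Qcol_ex[OF assms(1)] ..
  then have "rat_of_int (bform s (Qcol s u) b) = d u * of_int (b u)"
    using assms(2) by blast
  then show ?thesis using assms(3) by simp
qed


section \<open>Twisting a seed\<close>

definition twisting :: "'v set \<Rightarrow> 'v set \<Rightarrow> (('v \<Rightarrow> int) \<Rightarrow> ('v \<Rightarrow> int)) \<Rightarrow> bool" where
  "twisting V U L \<longleftrightarrow> bij_betw L (vecs V) (vecs V) \<and>
     (\<forall>a \<in> vecs V. \<forall>b \<in> vecs V. \<forall>x y. L (\<lambda>v. x * a v + y * b v) = (\<lambda>v. x * L a v + y * L b v)) \<and>
     (\<forall>a \<in> vecs V. \<forall>u \<in> U. L a u = a u)"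

definition twisted ::
    "nat \<Rightarrow> 'k::division_ring \<Rightarrow> ('v, 'k) qseed \<Rightarrow> ('v, 'k) qseed \<Rightarrow>
     (('v \<Rightarrow> int) \<Rightarrow> ('v \<Rightarrow> int)) \<Rightarrow> bool" where
  "twisted n h s s' L \<longleftrightarrow> quantum_seed n h s \<and> quantum_seed n h s' \<and>
     verts s' = verts s \<and> muts s' = muts s \<and> twisting (verts s) (muts s) L \<and>
     (\<forall>a \<in> vecs (verts s). Mm s' a = Mm s (L a)) \<and>
     (\<forall>v \<in> muts s. L (Qcol s' v) = Qcol s v)"

lemma twisting_vecs: "twisting V U L \<Longrightarrow> a \<in> vecs V \<Longrightarrow> L a \<in> vecs V"
  by (auto simp: twisting_def bij_betw_def)

lemma twisting_lin:
  "twisting V U L \<Longrightarrow> a \<in> vecs V \<Longrightarrow> b \<in> vecs V \<Longrightarrow>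
    L (\<lambda>v. x * a v + y * b v) = (\<lambda>v. x * L a v + y * L b v)"
  by (simp add: twisting_def)

lemma twisting_coord: "twisting V U L \<Longrightarrow> a \<in> vecs V \<Longrightarrow> u \<in> U \<Longrightarrow> L a u = a u"
  by (simp add: twisting_def)

lemma twisting_bij: "twisting V U L \<Longrightarrow> bij_betw L (vecs V) (vecs V)"
  by (simp add: twisting_def)

lemma twisting_add:
  "twisting V U L \<Longrightarrow> a \<in> vecs V \<Longrightarrow> b \<in> vecs V \<Longrightarrow> L (\<lambda>v. a v + b v) = (\<lambda>v. L a v + L b v)"
  using twisting_lin[of V U L a b 1 1] by simp

lemma twisting_diff:
  "twisting V U L \<Longrightarrow> a \<in> vecs V \<Longrightarrow> b \<in> vecs V \<Longrightarrow> L (\<lambda>v. a v - b v) = (\<lambda>v. L a v - L b v)"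
  using twisting_lin[of V U L a b 1 "-1"] by simp

lemma twisting_scale:
  "twisting V U L \<Longrightarrow> a \<in> vecs V \<Longrightarrow> L (\<lambda>v. x * a v) = (\<lambda>v. x * L a v)"
  using twisting_lin[of V U L a a x 0] by simp

lemma twisting_zero: "twisting V U L \<Longrightarrow> L (\<lambda>_. 0) = (\<lambda>_. 0)"
  using twisting_scale[of V U L "\<lambda>_. 0" 0] by simp

lemma twisting_inv:
  assumes "twisting V U L"
  shows "twisting V U (inv_into (vecs V) L)"
proof -
  let ?I = "inv_into (vecs V) L"
  have bij: "bij_betw ?I (vecs V) (vecs V)"
    by (rule bij_betw_inv_into[OF twisting_bij[OF assms]])
  have I: "?I a \<in> vecs V" "L (?I a) = a" if "a \<in> vecs V" for a
    using bij that twisting_bij[OF assms] by (auto simp: bij_betw_def f_inv_into_f)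
  have inj: "?I b = a" if "a \<in> vecs V" "L a = b" for a b
    using that twisting_bij[OF assms] by (auto simp: bij_betw_def)
  show ?thesis unfolding twisting_def
  proof (intro conjI ballI allI bij)
    fix a b x y assume "a \<in> vecs V" "b \<in> vecs V"
    then show "?I (\<lambda>v. x * a v + y * b v) = (\<lambda>v. x * ?I a v + y * ?I b v)"
      using I by (intro inj) (auto intro!: vecs_intros simp: twisting_lin[OF assms])
  next
    fix a u assume "a \<in> vecs V" "u \<in> U"
    then show "?I a u = a u" using I twisting_coord[OF assms, of "?I a" u] by simp
  qed
qed

text \<open>Links the abstract map \<open>L\<close> with its matrix, the form in which
  \<open>seed_qc\<close> is written.\<close>

lemma twisting_expand:
  assumes "finite V" "twisting V U L" "a \<in> vecs V"
  shows "L a = (\<lambda>u. \<Sum>v\<in>V. a v * L (unitv v) u)"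
  using assms(1,3)
proof (induction rule: vecs_induct)
  case zero
  then show ?case by (simp add: twisting_zero[OF assms(2)])
next
  case (plus a w)
  have "L (\<lambda>v. a v + unitv w v) = (\<lambda>u. L a u + L (unitv w) u)"
    using plus by (intro twisting_add[OF assms(2)]) auto
  also have "\<dots> = (\<lambda>u. (\<Sum>v\<in>V. a v * L (unitv v) u) + (\<Sum>v\<in>V. if w = v then L (unitv v) u else 0))"
    using plus assms(1) by (simp add: fun_cong[OF plus.IH])
  also have "\<dots> = (\<lambda>u. \<Sum>v\<in>V. (a v + unitv w v) * L (unitv v) u)"
    by (auto simp: sum.distrib[symmetric] unitv_def algebra_simps intro!: sum.cong)
  finally show ?case .
next
  case (minus a w)
  have "L (\<lambda>v. a v - unitv w v) = (\<lambda>u. L a u - L (unitv w) u)"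
    using minus by (intro twisting_diff[OF assms(2)]) auto
  also have "\<dots> = (\<lambda>u. (\<Sum>v\<in>V. a v * L (unitv v) u) - (\<Sum>v\<in>V. if w = v then L (unitv v) u else 0))"
    using minus assms(1) by (simp add: fun_cong[OF minus.IH])
  also have "\<dots> = (\<lambda>u. \<Sum>v\<in>V. (a v - unitv w v) * L (unitv v) u)"
    by (auto simp: sum_subtractf[symmetric] unitv_def algebra_simps intro!: sum.cong)
  finally show ?case .
qed

lemma bform_sum_left:
  "bform s (\<lambda>u. \<Sum>i\<in>I. x i * f i u) b = (\<Sum>i\<in>I. x i * bform s (f i) b)"
proof -
  have "bform s (\<lambda>u. \<Sum>i\<in>I. x i * f i u) b =
      (\<Sum>u\<in>verts s. \<Sum>v\<in>verts s. \<Sum>i\<in>I. x i * (f i u * Pm s u v * b v))"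
    unfolding bform_def by (simp add: sum_distrib_right mult.assoc)
  also have "\<dots> = (\<Sum>u\<in>verts s. \<Sum>i\<in>I. \<Sum>v\<in>verts s. x i * (f i u * Pm s u v * b v))"
    by (intro sum.cong refl sum.swap)
  also have "\<dots> = (\<Sum>i\<in>I. \<Sum>u\<in>verts s. \<Sum>v\<in>verts s. x i * (f i u * Pm s u v * b v))"
    by (rule sum.swap)
  finally show ?thesis by (simp add: bform_def sum_distrib_left)
qed

lemma bform_sum_right:
  assumes "quantum_seed n h s"
  shows "bform s a (\<lambda>u. \<Sum>i\<in>I. x i * f i u) = (\<Sum>i\<in>I. x i * bform s a (f i))"
  unfolding bform_swap[OF assms, of a] bform_sum_left by (simp add: sum_negf)

lemma bform_twisting:
  assumes "quantum_seed n h s" "twisting (verts s) U L" "verts s' = verts s"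
    and "\<And>u v. u \<in> verts s \<Longrightarrow> v \<in> verts s \<Longrightarrow> Pm s' u v = bform s (L (unitv u)) (L (unitv v))"
    and "a \<in> vecs (verts s)" "b \<in> vecs (verts s)"
  shows "bform s' a b = bform s (L a) (L b)"
proof -
  note ex = twisting_expand[OF quantum_seed_finite[OF assms(1)] assms(2)]
  show ?thesis
    unfolding ex[OF assms(5)] ex[OF assms(6)] bform_sum_left bform_sum_right[OF assms(1)]
    unfolding bform_def[of s'] assms(3)
    by (auto simp: assms(4) sum_distrib_left mult_ac intro!: sum.cong)
qed

lemma qtorus_reindex:
  assumes "bij_betw L (vecs (verts s)) (vecs (verts s))" "verts s' = verts s"
    and "\<And>a. a \<in> vecs (verts s) \<Longrightarrow> Mm s' a = Mm s (L a)"
  shows "qtorus h s \<subseteq> qtorus h s'"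
proof
  fix x assume "x \<in> qtorus h s"
  then obtain K c where K: "x = (\<Sum>a\<in>K. ev h (c a) * Mm s a)" "finite K" "K \<subseteq> vecs (verts s)"
    unfolding qtorus_def by blast
  let ?I = "inv_into (vecs (verts s)) L"
  have bij: "bij_betw ?I (vecs (verts s)) (vecs (verts s))"
    using assms(1) by (rule bij_betw_inv_into)
  then have inj: "inj_on ?I K" using K(3) by (meson bij_betw_imp_inj_on inj_on_subset)
  have sub: "?I ` K \<subseteq> vecs (verts s)" using bij K(3) by (auto simp: bij_betw_def)
  have LI: "L (?I a) = a" if "a \<in> K" for a
    using that K(3) assms(1) by (auto simp: bij_betw_def f_inv_into_f)
  have "(\<Sum>b\<in>?I ` K. ev h (c (L b)) * Mm s' b) = x"
    unfolding K(1) sum.reindex[OF inj] using sub by (intro sum.cong) (auto simp: LI assms(3))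
  then show "x \<in> qtorus h s'"
    unfolding qtorus_def using sub K(2) assms(2) by force
qed

text \<open>Transport of structure along \<open>L\<close> makes \<open>s'\<close> a quantum seed.
  The clause with content is compatibility: pairing column \<open>u\<close> of \<open>s'\<close>
  with a unit vector equals pairing column \<open>u\<close> of \<open>s\<close> with its image under
  \<open>L\<close>, and that image has the same coordinate at \<open>u\<close>. So the same numbers
  \<open>d\<close> work.\<close>

lemma twistedI:
  fixes s s' :: "('a, 'k::division_ring) qseed"
  assumes s: "quantum_seed n h s" and L: "twisting (verts s) (muts s) L"
    and V: "verts s' = verts s" and U: "muts s' = muts s"
    and Qm: "\<And>u v. u \<in> verts s \<Longrightarrow> v \<in> verts s \<Longrightarrow> Qm s' u v = - Qm s' v u"
      "\<And>u v. u \<in> verts s \<Longrightarrow> v \<in> verts s \<Longrightarrow> 2 * Qm s' u v \<in> \<int>"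
      "\<And>u v. u \<in> verts s \<Longrightarrow> v \<in> muts s \<Longrightarrow> Qm s' u v \<in> \<int>"
    and Pm: "\<And>u v. u \<in> verts s \<Longrightarrow> v \<in> verts s \<Longrightarrow> Pm s' u v = bform s (L (unitv u)) (L (unitv v))"
    and Mm: "\<And>a. a \<in> vecs (verts s) \<Longrightarrow> Mm s' a = Mm s (L a)"
    and Qcol: "\<And>v. v \<in> muts s \<Longrightarrow> L (Qcol s' v) = Qcol s v"
  shows "twisted n h s s' L"
proof -
  note fin = quantum_seed_finite[OF s] and mv = quantum_seed_muts[OF s]
  note bf = bform_twisting[OF s L V Pm]
  note LV = twisting_vecs[OF L]
  have mult: "Mm s' a * Mm s' b = h powi (int n * bform s' a b) * Mm s' (\<lambda>v. a v + b v)"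
    if "a \<in> vecs (verts s)" "b \<in> vecs (verts s)" for a b
    using Mm_mult[OF s LV LV] that
    by (simp add: Mm bf twisting_add[OF L] vecs_add)
  obtain d where d: "\<forall>u \<in> muts s. d u > 0 \<and>
      (\<forall>b. rat_of_int (bform s (Qcol s u) b) = d u * of_int (b u))"
    using bform_Qcol_ex[OF s] ..
  have compat: "(\<Sum>k \<in> verts s. Qm s' k u * of_int (Pm s' k v)) = (if u = v then d u else 0)"
    if "u \<in> muts s" "v \<in> verts s" for u v
  proof -
    have "bform s' (Qcol s' u) (unitv v) =
        (\<Sum>k \<in> verts s. \<Sum>w \<in> verts s. if w = v then Qcol s' u k * Pm s' k v else 0)"
      unfolding bform_def V by (intro sum.cong refl) (auto simp: unitv_def)
    also have "\<dots> = (\<Sum>k \<in> verts s. Qcol s' u k * Pm s' k v)"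
      using fin that by simp
    finally have "(\<Sum>k \<in> verts s. Qm s' k u * of_int (Pm s' k v)) =
        rat_of_int (bform s' (Qcol s' u) (unitv v))"
      using Qm(3)[OF _ that(1)] by (simp add: Qcol_def V)
    also have "bform s' (Qcol s' u) (unitv v) = bform s (Qcol s u) (L (unitv v))"
      using that Qcol_vecs[of s' u] by (simp add: bf Qcol V)
    also have "rat_of_int \<dots> = d u * of_int (L (unitv v) u)"
      using d that by simp
    also have "L (unitv v) u = unitv v u"
      using that by (intro twisting_coord[OF L]) auto
    finally show ?thesis by (auto simp: unitv_def)
  qed
  have indep: "\<forall>a \<in> K. c a = 0"
    if K: "finite K" "K \<subseteq> vecs (verts s)" "(\<Sum>a \<in> K. ev h (c a) * Mm s' a) = 0" for K c
  proof
    fix a assume a: "a \<in> K"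
    have inj: "inj_on L K"
      using twisting_bij[OF L] K(2) by (meson bij_betw_imp_inj_on inj_on_subset)
    have "(\<Sum>b \<in> L ` K. ev h (c (inv_into K L b)) * Mm s b) = (\<Sum>a \<in> K. ev h (c a) * Mm s' a)"
      unfolding sum.reindex[OF inj] using K(2) inj by (intro sum.cong) (auto simp: Mm)
    moreover have "L ` K \<subseteq> vecs (verts s)" using K(2) LV by auto
    ultimately have "c (inv_into K L (L a)) = 0"
      using quantum_seed_indep[OF s, where c = "\<lambda>b. c (inv_into K L b)" and K = "L ` K" and a = "L a"]
        K(1,3) a by auto
    then show "c a = 0" using inj a by simp
  qed
  have "quantum_seed n h s'"
    unfolding quantum_seed_def V U
  proof (intro conjI)
    show "h \<noteq> 0" "\<forall>x. h * x = x * h" using s by (simp_all add: quantum_seed_def)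
    show "finite (verts s)" "muts s \<subseteq> verts s" using fin mv by auto
    show "\<forall>u \<in> verts s. \<forall>v \<in> verts s. Qm s' u v = - Qm s' v u \<and> 2 * Qm s' u v \<in> \<int> \<and>
        (v \<in> muts s \<longrightarrow> Qm s' u v \<in> \<int>)"
      using Qm by blast
    show "\<forall>u \<in> verts s. \<forall>v \<in> verts s. Pm s' u v = - Pm s' v u"
    proof (intro ballI)
      fix u v assume "u \<in> verts s" "v \<in> verts s"
      then show "Pm s' u v = - Pm s' v u"
        using bform_swap[OF s, of "L (unitv u)" "L (unitv v)"] by (simp add: Pm)
    qed
    show "\<exists>d. \<forall>u \<in> muts s. d u > 0 \<and> (\<forall>v \<in> verts s.
        (\<Sum>k \<in> verts s. Qm s' k u * of_int (Pm s' k v)) = (if u = v then d u else 0))"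
      using d compat by (intro exI[of _ d]) auto
    show "\<forall>a \<in> vecs (verts s). \<forall>b \<in> vecs (verts s). Mm s' a * Mm s' b =
        h powi (int n * (\<Sum>u \<in> verts s. \<Sum>v \<in> verts s. a u * Pm s' u v * b v)) *
          Mm s' (\<lambda>v. a v + b v)"
      using mult unfolding bform_def V by blast
    show "\<forall>K c. finite K \<and> K \<subseteq> vecs (verts s) \<and> (\<Sum>a \<in> K. ev h (c a) * Mm s' a) = 0
        \<longrightarrow> (\<forall>a \<in> K. c a = 0)"
    proof (intro allI impI)
      fix K :: "('a \<Rightarrow> int) set" and c
      assume "finite K \<and> K \<subseteq> vecs (verts s) \<and> (\<Sum>a \<in> K. ev h (c a) * Mm s' a) = 0"
      then show "\<forall>a \<in> K. c a = 0" using indep[of K c] by (elim conjE)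
    qed
    have "\<forall>x. \<exists>a \<in> qtorus h s. \<exists>b \<in> qtorus h s. b \<noteq> 0 \<and> x = a * inverse b"
      using s unfolding quantum_seed_def by (elim conjE)
    then show "\<forall>x. \<exists>a \<in> qtorus h s'. \<exists>b \<in> qtorus h s'. b \<noteq> 0 \<and> x = a * inverse b"
      using qtorus_reindex[OF twisting_bij[OF L] V Mm, of h] by (meson subsetD)
  qed
  then show ?thesis using s L V U Mm Qcol by (simp add: twisted_def)
qed

lemma twisted_sym:
  assumes "twisted n h s s' L"
  shows "twisted n h s' s (inv_into (vecs (verts s)) L)"
proof -
  have L: "twisting (verts s) (muts s) L" and V: "verts s' = verts s" and U: "muts s' = muts s"
    using assms by (auto simp: twisted_def)
  have I: "inv_into (vecs (verts s)) L a \<in> vecs (verts s)" "L (inv_into (vecs (verts s)) L a) = a"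
    if "a \<in> vecs (verts s)" for a
    using twisting_vecs[OF twisting_inv[OF L]] that twisting_bij[OF L]
    by (auto simp: bij_betw_def f_inv_into_f)
  have "inv_into (vecs (verts s)) L (Qcol s v) = Qcol s' v" if "v \<in> muts s" for v
    using assms that twisting_bij[OF L] Qcol_vecs[of s' v] unfolding twisted_def bij_betw_def V
    by (metis inv_into_f_f)
  then show ?thesis
    using assms I twisting_inv[OF L] by (simp add: twisted_def)
qed


section \<open>Mutation of twisted seeds\<close>

text \<open>Brings the symmetric mutation rule to the form in which the sign of the single entry
  \<open>b\<close> selects one of the two exchange vectors. The division by 2 disappears, which also
  gives integrality.\<close>

lemma abs_mult_max:
  fixes p b :: "'a::linordered_field"
  shows "(\<bar>p\<bar> * b + p * \<bar>b\<bar>) / 2 = b * max 0 ((if 0 \<le> b then 1 else -1) * p)"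
  by (auto simp: max_def abs_if)

lemma exch_vec_eq:
  assumes "quantum_seed n h s" "k \<in> muts s"
  shows "exch_vec s k (of_int e) = (\<lambda>j. max 0 (e * Qcol s k j) - unitv k j)"
proof
  fix j
  show "exch_vec s k (of_int e) j = max 0 (e * Qcol s k j) - unitv k j"
  proof (cases "j \<in> verts s")
    case True
    have "max 0 (of_int e * Qm s j k) = rat_of_int (max 0 (e * Qcol s k j))"
      using of_int_Qcol[OF assms(1) True assms(2)] by (simp add: of_int_max)
    then show ?thesis using True by (simp add: exch_vec_def)
  next
    case False
    then have "j \<noteq> k" using quantum_seed_muts[OF assms] by auto
    then show ?thesis using False by (simp add: exch_vec_def Qcol_def)
  qed
qed

lemma mut_matrix_skew:
  assumes "quantum_seed n h s" "k \<in> muts s" "u \<in> verts s" "v \<in> verts s"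
  shows "mut_matrix k (Qm s) u v = - mut_matrix k (Qm s) v u"
  using quantum_seed_skew[OF assms(1,3,4)] quantum_seed_muts[OF assms(1,2)]
    quantum_seed_skew[OF assms(1,3), of k] quantum_seed_skew[OF assms(1) _ assms(4), of k]
  by (auto simp: mut_matrix_def field_simps)

lemma mut_matrix_summand_int:
  assumes "quantum_seed n h s" "k \<in> muts s" "u \<in> verts s" "v \<in> verts s"
  shows "(\<bar>Qm s u k\<bar> * Qm s k v + Qm s u k * \<bar>Qm s k v\<bar>) / 2 \<in> \<int>"
proof -
  have "Qm s k v = - Qm s v k"
    using quantum_seed_skew[OF assms(1) _ assms(4)] quantum_seed_muts[OF assms(1,2)] by blast
  then have "Qm s u k \<in> \<int>" "Qm s k v \<in> \<int>"
    using quantum_seed_int[OF assms(1) _ assms(2)] assms(3,4) by auto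
  then show ?thesis unfolding abs_mult_max by (auto simp: max_def)
qed

lemma mut_matrix_half_int:
  assumes "quantum_seed n h s" "k \<in> muts s" "u \<in> verts s" "v \<in> verts s"
  shows "2 * mut_matrix k (Qm s) u v \<in> \<int>"
proof -
  have "2 * Qm s u v + 2 * ((\<bar>Qm s u k\<bar> * Qm s k v + Qm s u k * \<bar>Qm s k v\<bar>) / 2) \<in> \<int>"
    by (intro Ints_add Ints_mult Ints_numeral mut_matrix_summand_int[OF assms]
      quantum_seed_half_int[OF assms(1,3,4)])
  then show ?thesis
    using quantum_seed_half_int[OF assms(1,3,4)] by (auto simp: mut_matrix_def distrib_left)
qed

lemma mut_matrix_int:
  assumes "quantum_seed n h s" "k \<in> muts s" "u \<in> verts s" "v \<in> muts s"
  shows "mut_matrix k (Qm s) u v \<in> \<int>"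
  using quantum_seed_int[OF assms(1,3,4)]
    mut_matrix_summand_int[OF assms(1,2,3) quantum_seed_muts[OF assms(1,4)]]
  by (auto simp: mut_matrix_def)

lemma Qcol_mut_self:
  assumes "quantum_seed n h s" "k \<in> muts s" "verts t = verts s"
    and "\<And>i j. i \<in> verts s \<Longrightarrow> j \<in> verts s \<Longrightarrow> Qm t i j = mut_matrix k (Qm s) i j"
  shows "Qcol t k = (\<lambda>j. - Qcol s k j)"
proof
  fix j
  show "Qcol t k j = - Qcol s k j"
  proof (cases "j \<in> verts s")
    case True
    then have "Qm t j k = of_int (- Qcol s k j)"
      using assms(4)[OF True quantum_seed_muts[OF assms(1,2)]] of_int_Qcol[OF assms(1) _ assms(2)]
      by (simp add: mut_matrix_def)
    then show ?thesis using True assms(3) by (simp only: Qcol_def) simp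
  qed (simp add: Qcol_def assms(3))
qed

lemma Qcol_diag: "quantum_seed n h s \<Longrightarrow> k \<in> muts s \<Longrightarrow> Qcol s k k = 0"
  using quantum_seed_skew[of n h s k k] quantum_seed_muts[of n h s k] by (simp add: Qcol_def)

text \<open>A column mutates by a multiple of one exchange vector. The last summand accounts for the
  sign change at \<open>k\<close>: the exchange vector has coordinate -1 there, so the two
  corrections subtract the old entry twice.\<close>

lemma Qcol_mut_other:
  assumes "quantum_seed n h s" "k \<in> muts s" "v \<in> muts s" "v \<noteq> k" "verts t = verts s"
    and "\<And>i j. i \<in> verts s \<Longrightarrow> j \<in> verts s \<Longrightarrow> Qm t i j = mut_matrix k (Qm s) i j"
  shows "Qcol t v = (\<lambda>j. Qcol s v j +
    Qcol s v k * exch_vec s k (if 0 \<le> Qcol s v k then 1 else -1) j - Qcol s v k * unitv k j)"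
proof
  fix j
  define \<epsilon> :: int where "\<epsilon> = (if 0 \<le> Qcol s v k then 1 else -1)"
  note kv = quantum_seed_muts[OF assms(1,2)] quantum_seed_muts[OF assms(1,3)]
  note Qk = of_int_Qcol[OF assms(1) _ assms(2), symmetric]
    and Qv = of_int_Qcol[OF assms(1) _ assms(3), symmetric]
  have ex: "exch_vec s k (if 0 \<le> Qcol s v k then 1 else -1) =
      (\<lambda>j. max 0 (\<epsilon> * Qcol s k j) - unitv k j)"
    using exch_vec_eq[OF assms(1,2), of \<epsilon>] by (simp add: \<epsilon>_def split: if_splits)
  show "Qcol t v j = Qcol s v j +
    Qcol s v k * exch_vec s k (if 0 \<le> Qcol s v k then 1 else -1) j - Qcol s v k * unitv k j"
  proof (cases "j \<in> verts s")
    case j: True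
    have "Qm t j v = of_int (Qcol s v j +
        Qcol s v k * (max 0 (\<epsilon> * Qcol s k j) - unitv k j) - Qcol s v k * unitv k j)"
    proof (cases "j = k")
      case True
      then show ?thesis
        using assms(6)[OF j kv(2)] kv Qcol_diag[OF assms(1,2)]
        by (simp add: mut_matrix_def Qv)
    next
      case False
      have "Qm t j v = Qm s j v + Qm s k v * max 0 ((if 0 \<le> Qm s k v then 1 else -1) * Qm s j k)"
        using assms(6)[OF j kv(2)] False assms(4) by (simp add: mut_matrix_def abs_mult_max)
      also have "\<dots> = of_int (Qcol s v j + Qcol s v k * max 0 (\<epsilon> * Qcol s k j))"
        using j kv by (simp add: Qk Qv \<epsilon>_def of_int_max)
      finally show ?thesis using False by simp
    qed
    then show ?thesis unfolding ex using j assms(5) by (simp only: Qcol_def[of t] floor_of_int if_True)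
  next
    case False
    then have "j \<noteq> k" using kv by auto
    then show ?thesis unfolding ex using False assms(5) by (simp add: Qcol_def)
  qed
qed

lemma exch_vec_vecs: "exch_vec s k e \<in> vecs (verts s)"
  by (simp add: exch_vec_def vecs_def)

lemma exch_vec_diff:
  assumes "quantum_seed n h s" "k \<in> muts s"
  shows "exch_vec s k 1 j - exch_vec s k (-1) j = Qcol s k j"
  using exch_vec_eq[OF assms, of 1] exch_vec_eq[OF assms, of "-1"] by (auto simp: max_def)

text \<open>The new map is \<open>L\<close> followed by a shear along \<delta>. The shear can be
  undone because coordinate \<open>k\<close> survives both maps and determines the multiple of
  \<delta> that was added.\<close>

lemma twisting_shift:
  assumes L: "twisting V U L" and k: "k \<in> U" "k \<in> V"
    and \<delta>: "\<delta> \<in> vecs V" "\<And>u. u \<in> U \<Longrightarrow> \<delta> u = 0"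
  shows "twisting V U (\<lambda>a v. L a v + a k * \<delta> v)" (is "twisting V U ?L")
proof -
  have LV: "?L a \<in> vecs V" if "a \<in> vecs V" for a
    using that \<delta> by (intro vecs_intros twisting_vecs[OF L])
  have coord: "?L a u = a u" if "a \<in> vecs V" "u \<in> U" for a u
    using that \<delta> by (simp add: twisting_coord[OF L])
  have "inj_on ?L (vecs V)"
  proof (rule inj_onI)
    fix a b assume ab: "a \<in> vecs V" "b \<in> vecs V" "?L a = ?L b"
    then have "a k = b k" using coord[OF ab(1) k(1)] coord[OF ab(2) k(1)] by metis
    then have "L a = L b" using fun_cong[OF ab(3)] by auto
    then show "a = b" using twisting_bij[OF L] ab by (auto simp: bij_betw_def inj_on_def)
  qed
  moreover have "b \<in> ?L ` vecs V" if b: "b \<in> vecs V" for b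
  proof -
    have "(\<lambda>v. b v - b k * \<delta> v) \<in> vecs V" using b \<delta> by (intro vecs_intros)
    then obtain a where a: "a \<in> vecs V" "L a = (\<lambda>v. b v - b k * \<delta> v)"
      using twisting_bij[OF L] unfolding bij_betw_def by (metis imageE)
    have "a k = b k" using twisting_coord[OF L a(1) k(1)] a(2) \<delta>(2)[OF k(1)] by simp
    then have "?L a = b" using a(2) by simp
    then show ?thesis using a(1) by blast
  qed
  ultimately have "bij_betw ?L (vecs V) (vecs V)"
    using LV unfolding bij_betw_def by blast
  then show ?thesis
    unfolding twisting_def using coord by (simp add: twisting_lin[OF L] algebra_simps)
qed

text \<open>The two exchange monomials of the twisted seed differ from the untwisted ones by the same
  frozen monomial \<open>f\<close>, because the twist matches the columns of the exchange matrices. So the new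
  cluster variables again differ by a frozen monomial.\<close>

lemma twisted_mutates:
  assumes tw: "twisted n h s s' L" and n: "n \<ge> 1" and mu: "mutates n h k s t"
  shows "\<exists>t' L'. mutates n h k s' t' \<and> twisted n h t t' L'"
proof -
  have s: "quantum_seed n h s" and s': "quantum_seed n h s'" and V': "verts s' = verts s"
    and U': "muts s' = muts s" and L: "twisting (verts s) (muts s) L"
    and MM: "\<And>a. a \<in> vecs (verts s) \<Longrightarrow> Mm s' a = Mm s (L a)"
    and QQ: "\<And>v. v \<in> muts s \<Longrightarrow> L (Qcol s' v) = Qcol s v"
    using tw by (auto simp: twisted_def)
  have k: "k \<in> muts s" and t: "quantum_seed n h t" and V: "verts t = verts s"
    and U: "muts t = muts s"
    and Qt: "\<And>i j. i \<in> verts s \<Longrightarrow> j \<in> verts s \<Longrightarrow> Qm t i j = mut_matrix k (Qm s) i j"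
    and Mt: "\<And>v. v \<in> verts s - {k} \<Longrightarrow> Mm t (unitv v) = Mm s (unitv v)"
    and Mtk: "Mm t (unitv k) = Mm s (exch_vec s k 1) + Mm s (exch_vec s k (-1))"
    using mu by (auto simp: mutates_def)
  have k': "k \<in> muts s'" and kV: "k \<in> verts s"
    using k U' quantum_seed_muts[OF s] by auto
  define x y x' y' where "x = exch_vec s k 1" and "y = exch_vec s k (-1)"
    and "x' = exch_vec s' k 1" and "y' = exch_vec s' k (-1)"
  have xV: "x \<in> vecs (verts s)" "y \<in> vecs (verts s)" "x' \<in> vecs (verts s)" "y' \<in> vecs (verts s)"
    unfolding x_def y_def x'_def y'_def
    using exch_vec_vecs[of s k] exch_vec_vecs[of s' k] V' by auto
  have xy: "Qcol s k = (\<lambda>v. x v - y v)" "Qcol s' k = (\<lambda>v. x' v - y' v)"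
    using exch_vec_diff[OF s k] exch_vec_diff[OF s' k']
    by (auto simp: x_def y_def x'_def y'_def)
  have agree: "Mm t a = Mm s a" if "a \<in> vecs (verts s)" "a k = 0" for a
  proof (rule Mm_eq_on_common_variables[OF s t n V])
    show "a \<in> vecs (verts s - {k})" using that by (auto simp: vecs_def)
  qed (use Mt in auto)
  define f where "f = (\<lambda>v. L x' v - x v)"
  have fV: "f \<in> vecs (verts s)" unfolding f_def using xV by (intro vecs_intros twisting_vecs[OF L])
  have Qcol_coord: "Qcol s' k u = Qcol s k u" if "u \<in> muts s" for u
    using twisting_coord[OF L _ that, of "Qcol s' k"] QQ[OF k] Qcol_vecs[of s' k] V' by simp
  \<comment> \<open>At mutable vertices the columns of \<open>s\<close> and \<open>s'\<close> at
    \<open>k\<close> agree, hence so do the exchange vectors, and \<open>L\<close> leaves these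
    coordinates alone.\<close>
  have f0: "f u = 0" if "u \<in> muts s" for u
    using twisting_coord[OF L xV(3) that] Qcol_coord[OF that] exch_vec_eq[OF s k, of 1]
      exch_vec_eq[OF s' k', of 1] by (simp add: f_def x_def x'_def)
  have Lx: "L x' = (\<lambda>v. x v + f v)" by (simp add: f_def)
  have "(\<lambda>v. L x' v - L y' v) = (\<lambda>v. x v - y v)"
    using QQ[OF k] twisting_diff[OF L xV(3,4)] by (simp add: xy)
  then have "L x' v - L y' v = x v - y v" for v by (rule fun_cong)
  then have Ly: "L y' = (\<lambda>v. y v + f v)"
    by (auto simp: f_def algebra_simps)
  \<comment> \<open>The choice that makes the new twist send the unit vector of \<open>k\<close> to
    itself plus \<open>f\<close>.\<close>
  define \<delta> where "\<delta> = (\<lambda>v. unitv k v + f v - L (unitv k) v)"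
  have ukV: "unitv k \<in> vecs (verts s)" using kV by simp
  have \<delta>V: "\<delta> \<in> vecs (verts s)"
    unfolding \<delta>_def using fV ukV by (intro vecs_intros twisting_vecs[OF L])
  have \<delta>0: "\<delta> u = 0" if "u \<in> muts s" for u
    using twisting_coord[OF L ukV that] f0[OF that] by (simp add: \<delta>_def)
  define L' where "L' = (\<lambda>a v. L a v + a k * \<delta> v)"
  have L': "twisting (verts s) (muts s) L'"
    unfolding L'_def by (rule twisting_shift[OF L k kV \<delta>V \<delta>0])
  \<comment> \<open>Defined as the twist of \<open>t\<close> by \<open>L'\<close>, so that being a
    quantum seed is covered by \<open>twistedI\<close>. What is left to check is that its variables
    and matrix are those of the mutation of \<open>s'\<close>.\<close>
  define t' where "t' = \<lparr>verts = verts s, muts = muts s, Qm = mut_matrix k (Qm s'),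
    Pm = (\<lambda>u v. bform t (L' (unitv u)) (L' (unitv v))), Mm = (\<lambda>a. Mm t (L' a))\<rparr>"
  have sel: "verts t' = verts s" "muts t' = muts s" "Qm t' = mut_matrix k (Qm s')"
    "Pm t' = (\<lambda>u v. bform t (L' (unitv u)) (L' (unitv v)))" "Mm t' = (\<lambda>a. Mm t (L' a))"
    by (simp_all add: t'_def)
  have Qcol_t': "L' (Qcol t' v) = Qcol t v" if v: "v \<in> muts s" for v
  proof (cases "v = k")
    case True
    have "Qcol t' k = (\<lambda>j. -1 * Qcol s' k j)"
      using Qcol_mut_self[OF s' k', of t'] sel V' by simp
    moreover have "Qcol t k = (\<lambda>j. - Qcol s k j)" by (rule Qcol_mut_self[OF s k V Qt])
    moreover have "L (\<lambda>j. -1 * Qcol s' k j) = (\<lambda>j. -1 * L (Qcol s' k) j)"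
      by (rule twisting_scale[OF L]) (use Qcol_vecs[of s' k] V' in simp)
    ultimately show ?thesis
      using True Qcol_diag[OF s' k'] QQ[OF k] by (simp add: L'_def)
  next
    case False
    define b where "b = Qcol s v k"
    have b': "Qcol s' v k = b"
      using twisting_coord[OF L _ k, of "Qcol s' v"] QQ[OF v] Qcol_vecs[of s' v] V'
      by (simp add: b_def)
    define w w' where "w = (if 0 \<le> b then x else y)" and "w' = (if 0 \<le> b then x' else y')"
    have w'V: "w' \<in> vecs (verts s)" using xV by (simp add: w'_def)
    have Lw: "L w' = (\<lambda>v. w v + f v)" using Lx Ly by (simp add: w_def w'_def)
    have QtV: "Qcol t v = (\<lambda>j. Qcol s v j + b * w j - b * unitv k j)"
      using Qcol_mut_other[OF s k v False V Qt] by (simp add: b_def w_def x_def y_def split: if_splits)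
    have Qt'V: "Qcol t' v = (\<lambda>j. Qcol s' v j + b * w' j - b * unitv k j)"
      using Qcol_mut_other[OF s' k' _ False, of t'] v sel V' U'
      by (simp add: b' w'_def x'_def y'_def split: if_splits)
    \<comment> \<open>So the mutated column has coordinate -b at \<open>k\<close>, and the shear
      adds -b times \<delta>. This removes the b times \<open>f\<close> coming from
      \<open>L w'\<close> and turns the image of the unit vector of \<open>k\<close> back into the
      unit vector.\<close>
    have "w' k = -1"
      using exch_vec_eq[OF s' k', of 1] exch_vec_eq[OF s' k', of "-1"] Qcol_diag[OF s' k']
      by (simp add: w'_def x'_def y'_def)
    then have ck: "Qcol t' v k = - b" using b' by (simp add: Qt'V)
    have "L (Qcol t' v) = (\<lambda>j. (L (Qcol s' v) j + b * L w' j) - b * L (unitv k) j)"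
      unfolding Qt'V using w'V ukV Qcol_vecs[of s' v] V'
      by (simp add: twisting_diff[OF L] twisting_add[OF L] twisting_scale[OF L] vecs_intros)
    then show ?thesis
      using ck QQ[OF v] by (auto simp: L'_def Lw QtV \<delta>_def algebra_simps)
  qed
  have twt: "twisted n h t t' L'"
  proof (rule twistedI[OF t])
    show "twisting (verts t) (muts t) L'" using L' V U by simp
  next
    fix u v assume "u \<in> verts t" "v \<in> verts t"
    then show "Qm t' u v = - Qm t' v u" "2 * Qm t' u v \<in> \<int>"
      using mut_matrix_skew[OF s' k', of u v] mut_matrix_half_int[OF s' k', of u v] V V' sel
      by simp_all
  next
    fix u v assume "u \<in> verts t" "v \<in> muts t"
    then show "Qm t' u v \<in> \<int>"
      using mut_matrix_int[OF s' k', of u v] V V' U U' sel by simp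
  qed (use sel V U Qcol_t' in simp_all)
  have b0: "bform s x f = bform s y f"
    using bform_Qcol[of n h s k f] s k f0[OF k] by (simp add: xy bform_diff_left)
  have ft: "Mm t f = Mm s f" using agree[OF fV f0[OF k]] .
  have comm: "bform t (unitv k) f = bform s x f"
  proof (rule commutation_exponent_unique[OF t n])
    show "Mm t (unitv k) * Mm t f = h powi (2 * int n * bform t (unitv k) f) * (Mm t f * Mm t (unitv k))"
      by (rule Mm_commute[OF t]) (use ukV fV V in simp_all)
    show "Mm t (unitv k) * Mm t f = h powi (2 * int n * bform s x f) * (Mm t f * Mm t (unitv k))"
      unfolding Mtk ft using Mm_commute[OF s xV(1) fV] Mm_commute[OF s xV(2) fV] b0
      by (simp add: x_def[symmetric] y_def[symmetric] distrib_left distrib_right)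
  qed (use Mm_nonzero[OF t] ukV fV V in auto)
  have "Mm t' (unitv k) = Mm t (\<lambda>v. unitv k v + f v)"
    by (simp add: sel L'_def \<delta>_def)
  also have "\<dots> = h powi (- (int n * bform s x f)) * ((Mm s x + Mm s y) * Mm s f)"
    using Mm_add[OF t, of "unitv k" f] ukV fV V by (simp add: comm ft Mtk x_def y_def)
  also have "\<dots> = Mm s (L x') + Mm s (L y')"
    unfolding Lx Ly using b0 by (simp add: Mm_add[OF s] xV fV distrib_left distrib_right)
  finally have new: "Mm t' (unitv k) = Mm s' x' + Mm s' y'" using MM xV by simp
  have old: "Mm t' (unitv v) = Mm s' (unitv v)" if v: "v \<in> verts s - {k}" for v
  proof -
    have "L (unitv v) k = unitv v k" using v by (intro twisting_coord[OF L _ k]) auto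
    then have "Mm t (L (unitv v)) = Mm s (L (unitv v))"
      using v by (intro agree twisting_vecs[OF L]) auto
    moreover have "k \<noteq> v" using v by auto
    ultimately show ?thesis using v MM by (simp add: sel L'_def)
  qed
  have "mutates n h k s' t'"
    unfolding mutates_def using twt new old sel V' U' k'
    by (simp add: twisted_def x'_def y'_def)
  then show ?thesis using twt by blast
qed


section \<open>Cluster algebras of twisted seeds\<close>

lemma mut_equiv_preserves:
  assumes "mut_equiv n h s t" "quantum_seed n h s"
  shows "quantum_seed n h t \<and> verts t = verts s \<and> muts t = muts s \<and>
    (\<forall>v \<in> verts s - muts s. Mm t (unitv v) = Mm s (unitv v))"
  using assms unfolding mut_equiv_def
proof (induction rule: rtranclp_induct)
  case (step t u)
  then obtain k where mu: "mutates n h k t u" by blast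
  have "Mm u (unitv v) = Mm s (unitv v)" if "v \<in> verts s - muts s" for v
  proof -
    have "v \<in> verts t - {k}" using that mu step by (auto simp: mutates_def)
    then show ?thesis using that mu step by (simp add: mutates_def)
  qed
  then show ?case using mu step by (simp add: mutates_def)
qed simp

lemma twisted_mut_equiv:
  assumes "mut_equiv n h s t" "twisted n h s s' L" "n \<ge> 1"
  shows "\<exists>t' L'. mut_equiv n h s' t' \<and> twisted n h t t' L'"
  using assms(1) unfolding mut_equiv_def
proof (induction rule: rtranclp_induct)
  case base
  then show ?case using assms(2) by blast
next
  case (step t u)
  then obtain t' L' k where t': "(\<lambda>s s'. \<exists>k. mutates n h k s s')\<^sup>*\<^sup>* s' t'" "twisted n h t t' L'"
    and "mutates n h k t u" by blast
  from twisted_mutates[OF t'(2) assms(3) this(3)] obtain u' K k where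
    "mutates n h k t' u'" "twisted n h u u' K" by blast
  then show ?case using t'(1) by (metis (mono_tags, lifting) rtranclp.rtrancl_into_rtrancl)
qed

lemma alg_gen_subset: "G \<subseteq> alg_gen h H \<Longrightarrow> alg_gen h G \<subseteq> alg_gen h H"
proof
  fix x assume G: "G \<subseteq> alg_gen h H" and "x \<in> alg_gen h G"
  from this(2) show "x \<in> alg_gen h H"
    by induction (use G in \<open>auto intro: alg_gen.intros\<close>)
qed

lemma alg_gen_powi_mult: "x \<in> alg_gen h G \<Longrightarrow> h powi m * x \<in> alg_gen h G"
  using alg_gen.mult[OF alg_gen.coeff[of h "om m"]] by simp

lemma cluster_algebra_variable:
  "mut_equiv n h s t \<Longrightarrow> v \<in> verts s \<Longrightarrow> Mm t (unitv v) \<in> cluster_algebra n h s"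
  unfolding cluster_algebra_def by (rule alg_gen.gen) blast

lemma cluster_algebra_initial:
  "v \<in> verts s \<Longrightarrow> Mm s (unitv v) \<in> cluster_algebra n h s"
  by (rule cluster_algebra_variable) (simp_all add: mut_equiv_def)

lemma cluster_algebra_frozen_inverse:
  "v \<in> verts s - muts s \<Longrightarrow> inverse (Mm s (unitv v)) \<in> cluster_algebra n h s"
  unfolding cluster_algebra_def by (rule alg_gen.gen) blast

lemma cluster_algebra_frozen_monomial:
  assumes s: "quantum_seed n h s" and a: "a \<in> vecs (verts s - muts s)"
  shows "Mm s a \<in> cluster_algebra n h s"
proof -
  have sub: "verts s - muts s \<subseteq> verts s" by blast
  have add: "Mm s (\<lambda>v. a v + b v) \<in> cluster_algebra n h s"
    if "a \<in> vecs (verts s)" "b \<in> vecs (verts s)"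
      "Mm s a \<in> cluster_algebra n h s" "Mm s b \<in> cluster_algebra n h s" for a b
    using that unfolding Mm_add[OF s that(1,2)] cluster_algebra_def
    by (intro alg_gen_powi_mult alg_gen.mult)
  have "finite (verts s - muts s)" using quantum_seed_finite[OF s] by simp
  then show ?thesis using a
  proof (induction rule: vecs_induct)
    case zero
    show ?case using alg_gen.coeff[of h 1] by (simp add: Mm_zero[OF s] cluster_algebra_def)
  next
    case (plus a u)
    then show ?case using vecs_mono[OF sub]
      by (intro add) (auto intro: cluster_algebra_initial)
  next
    case (minus a u)
    then have u: "unitv u \<in> vecs (verts s)" by auto
    have "Mm s (\<lambda>v. a v + - unitv u v) \<in> cluster_algebra n h s"
    proof (rule add)
      show "Mm s (\<lambda>v. - unitv u v) \<in> cluster_algebra n h s"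
        unfolding Mm_uminus[OF s u] using minus by (intro cluster_algebra_frozen_inverse)
    qed (use minus u vecs_mono[OF sub] in \<open>auto intro: vecs_uminus\<close>)
    then show ?case by simp
  qed
qed

text \<open>Frozen monomials are units in the algebra of \<open>s\<close>, so frozen factors do not
  leave it. \<open>twisted_sym\<close> turns the reverse inclusion into an instance of this
  one.\<close>

lemma twisted_cluster_algebra_subset:
  assumes tw: "twisted n h s s' L" and n: "n \<ge> 1"
  shows "cluster_algebra n h s' \<subseteq> cluster_algebra n h s"
proof -
  have s: "quantum_seed n h s" and s': "quantum_seed n h s'" and V': "verts s' = verts s"
    and U': "muts s' = muts s" and L: "twisting (verts s) (muts s) L"
    and MM: "\<And>a. a \<in> vecs (verts s) \<Longrightarrow> Mm s' a = Mm s (L a)"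
    using tw by (auto simp: twisted_def)
  have frozen: "a \<in> vecs (verts s - muts s)" if "a \<in> vecs (verts s)" "\<And>u. u \<in> muts s \<Longrightarrow> a u = 0"
    for a using that by (auto simp: vecs_def)
  have var: "Mm t' (unitv v) \<in> cluster_algebra n h s"
    if t': "mut_equiv n h s' t'" and v: "v \<in> verts s" for t' v
  proof -
    obtain t K where t: "mut_equiv n h s t" and "twisted n h t' t K"
      \<comment> \<open>The mutation sequence starts at \<open>s'\<close>; the inverse twist is what
        allows it to be repeated from \<open>s\<close>.\<close>
      using twisted_mut_equiv[OF t' twisted_sym[OF tw] n] by blast
    then obtain K' where tw': "twisted n h t t' K'" using twisted_sym by blast
    note pt = mut_equiv_preserves[OF t s]
    have K': "twisting (verts s) (muts s) K'" and tq: "quantum_seed n h t"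
      using tw' pt by (auto simp: twisted_def)
    have uv: "unitv v \<in> vecs (verts s)" using v by simp
    have eq: "Mm t' (unitv v) = Mm t (K' (unitv v))"
      using tw' pt uv by (simp add: twisted_def)
    \<comment> \<open>The generators contain inverses of frozen variables of the initial seed.
      Mutation never changes a frozen variable, so frozen monomials of \<open>t\<close> are those of
      \<open>s\<close>.\<close>
    have fz: "Mm t a \<in> cluster_algebra n h s" if "a \<in> vecs (verts s - muts s)" for a
    proof -
      have "Mm t a = Mm s a"
        by (rule Mm_eq_on_common_variables[OF s tq n, of "verts s - muts s"]) (use pt that in auto)
      then show ?thesis using cluster_algebra_frozen_monomial[OF s that] by simp
    qed
    show ?thesis
    proof (cases "v \<in> muts s")
      case True
      define g where "g = (\<lambda>u. K' (unitv v) u - unitv v u)"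
      have gV: "g \<in> vecs (verts s)"
        unfolding g_def using uv by (intro vecs_intros twisting_vecs[OF K'])
      have "g \<in> vecs (verts s - muts s)"
        by (rule frozen[OF gV]) (simp add: g_def twisting_coord[OF K' uv])
      moreover have "Mm t' (unitv v) = Mm t (\<lambda>u. unitv v u + g u)"
        by (simp add: eq g_def)
      ultimately show ?thesis
        using Mm_add[OF tq, of "unitv v" g] uv gV pt fz[of g] cluster_algebra_variable[OF t v]
        unfolding cluster_algebra_def by (auto intro: alg_gen_powi_mult alg_gen.mult)
    next
      case False
      have "K' (unitv v) \<in> vecs (verts s - muts s)"
        using False twisting_vecs[OF K' uv]
        by (intro frozen) (auto simp: twisting_coord[OF K' uv] intro!: unitv_other)
      then show ?thesis unfolding eq by (rule fz)
    qed
  qed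
  have inv: "inverse (Mm s' (unitv v)) \<in> cluster_algebra n h s" if v: "v \<in> verts s - muts s" for v
  proof -
    have uv: "unitv v \<in> vecs (verts s)" using v by simp
    have "inverse (Mm s' (unitv v)) = Mm s (L (\<lambda>u. - unitv v u))"
      using Mm_uminus[OF s', of "unitv v"] uv V' MM[OF vecs_uminus[OF uv]] by simp
    moreover have "L (\<lambda>u. - unitv v u) \<in> vecs (verts s - muts s)"
      using v vecs_uminus[OF uv] twisting_vecs[OF L vecs_uminus[OF uv]]
      by (intro frozen) (auto simp: twisting_coord[OF L] intro!: unitv_other)
    ultimately show ?thesis using cluster_algebra_frozen_monomial[OF s] by simp
  qed
  show ?thesis
    unfolding cluster_algebra_def[of n h s']
    unfolding cluster_algebra_def[of n h s]
  proof (rule alg_gen_subset, rule subsetI)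
    fix x
    assume "x \<in> {Mm t (unitv v) | t v. mut_equiv n h s' t \<and> v \<in> verts s'} \<union>
      {inverse (Mm s' (unitv v)) | v. v \<in> verts s' - muts s'}"
    then have "x \<in> cluster_algebra n h s" using var inv V' U' by auto
    then show "x \<in> alg_gen h ({Mm t (unitv v) | t v. mut_equiv n h s t \<and> v \<in> verts s} \<union>
        {inverse (Mm s (unitv v)) | v. v \<in> verts s - muts s})"
      unfolding cluster_algebra_def .
  qed
qed

lemma twisted_cluster_algebra:
  assumes "twisted n h s s' L" "n \<ge> 1"
  shows "cluster_algebra n h s' = cluster_algebra n h s"
  using twisted_cluster_algebra_subset[OF assms]
    twisted_cluster_algebra_subset[OF twisted_sym[OF assms(1)] assms(2)] by blast

text \<open>Since the map is the identity of the skew field, it extends to the localization as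
  itself, and condition (4) becomes the clause of \<open>twisted\<close> on columns.\<close>

lemma twisted_quasi_iso:
  assumes tw: "twisted n h s s' L" and n: "n \<ge> 1"
  shows "quasi_iso n h s' h s (\<lambda>x. x)"
proof -
  have s: "quantum_seed n h s" and s': "quantum_seed n h s'" and V': "verts s' = verts s"
    and U': "muts s' = muts s" and L: "twisting (verts s) (muts s) L"
    and MM: "\<And>a. a \<in> vecs (verts s) \<Longrightarrow> Mm s' a = Mm s (L a)"
    and QQ: "\<And>v. v \<in> muts s \<Longrightarrow> L (Qcol s' v) = Qcol s v"
    using tw by (auto simp: twisted_def)
  have uv: "unitv v \<in> vecs (verts s)" if "v \<in> verts s" for v using that by simp
  note mv = quantum_seed_muts[OF s]
  have Q: "Qm s' u v = Qm s u v" if "u \<in> muts s" "v \<in> muts s" for u v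
  proof -
    have "Qcol s' v u = Qcol s v u"
      using twisting_coord[OF L _ that(1), of "Qcol s' v"] QQ[OF that(2)] Qcol_vecs[of s' v] V' by simp
    then show ?thesis
      using of_int_Qcol[OF s, of u v] of_int_Qcol[OF s', of u v] that U' V' mv by simp
  qed
  have "quasi_hom n h s' h s (\<lambda>x. x)"
    unfolding quasi_hom_def U' V'
  proof (intro conjI ballI)
    show "alg_hom h (cluster_algebra n h s') h (cluster_algebra n h s) (\<lambda>x. x)"
      using twisted_cluster_algebra[OF assms] by (simp add: alg_hom_def)
    show "\<exists>g. alg_hom h (cluster_loc n h s') h UNIV g \<and> (\<forall>x \<in> cluster_algebra n h s'. g x = x) \<and>
        (\<forall>v \<in> muts s. g (Mm s' (Qcol s' v)) = Mm s (Qcol s v))"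
      using MM QQ Qcol_vecs[of s'] V' by (intro exI[of _ "\<lambda>x. x"]) (simp add: alg_hom_def)
  next
    fix v assume "v \<in> muts s"
    then show "\<exists>w \<in> vecs (verts s). Mm s' (unitv v) = Mm s w \<and> w v = 1 \<and> (\<forall>u \<in> muts s - {v}. w u = 0)"
      using mv uv MM by (intro bexI[of _ "L (unitv v)"]) (auto simp: twisting_coord[OF L] twisting_vecs[OF L])
  next
    fix v assume "v \<in> verts s - muts s"
    then show "\<exists>w \<in> vecs (verts s). Mm s' (unitv v) = Mm s w \<and> (\<forall>u \<in> muts s. w u = 0)"
      using uv MM
      by (intro bexI[of _ "L (unitv v)"]) (auto simp: twisting_coord[OF L] twisting_vecs[OF L] intro!: unitv_other)
  qed (use s s' Q in simp_all)
  then show ?thesis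
    using twisted_cluster_algebra[OF assms] by (simp add: quasi_iso_def bij_betw_def)
qed

text \<open>Cluster variables outside the initial seed are recovered from the exchange relations: the
  homomorphism fixes the product of the new variable with the old one, and the old one is not zero.\<close>

lemma alg_hom_determined_by_seed:
  assumes s: "quantum_seed n h s" and g: "alg_hom h (cluster_algebra n h s) h B g"
    and init: "\<And>v. v \<in> verts s \<Longrightarrow> g (Mm s (unitv v)) = Mm s (unitv v)"
    and x: "x \<in> cluster_algebra n h s"
  shows "g x = x"
proof -
  \<comment> \<open>The elements fixed by \<open>g\<close> form a subalgebra that is closed under
    cancelling a nonzero fixed right factor; exchange relations are divided in this way.\<close>
  define Fx where "Fx = {x \<in> cluster_algebra n h s. g x = x}"
  have gc: "g (ev h c) = ev h c" for c using g by (simp add: alg_hom_def)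
  have ga: "g (x + y) = g x + g y" "g (x * y) = g x * g y"
    if "x \<in> cluster_algebra n h s" "y \<in> cluster_algebra n h s" for x y
    using g that by (auto simp: alg_hom_def)
  have cl: "ev h c \<in> Fx" for c
    using gc by (simp add: Fx_def cluster_algebra_def alg_gen.coeff)
  have add: "x + y \<in> Fx" if "x \<in> Fx" "y \<in> Fx" for x y
    using that ga unfolding Fx_def by (auto simp: cluster_algebra_def intro: alg_gen.add)
  have mult: "x * y \<in> Fx" if "x \<in> Fx" "y \<in> Fx" for x y
    using that ga unfolding Fx_def by (auto simp: cluster_algebra_def intro: alg_gen.mult)
  have pow: "h powi m \<in> Fx" for m using cl[of "om m"] by simp
  have cancel: "x \<in> Fx"
    if "x \<in> cluster_algebra n h s" "y \<in> Fx" "x * y \<in> Fx" "y \<noteq> 0" for x y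
  proof -
    have "g x * y = x * y" using that ga(2)[of x y] by (simp add: Fx_def)
    then show ?thesis using that by (simp add: Fx_def)
  qed
  have vars: "\<forall>v \<in> verts s. Mm t (unitv v) \<in> Fx" if "mut_equiv n h s t" for t
    using that unfolding mut_equiv_def
  proof (induction rule: rtranclp_induct)
    case base
    show ?case using init cluster_algebra_initial by (auto simp: Fx_def)
  next
    case (step t u)
    then obtain k where mu: "mutates n h k t u" by blast
    have st: "mut_equiv n h s t" and su: "mut_equiv n h s u"
      using step by (auto simp: mut_equiv_def intro: rtranclp.rtrancl_into_rtrancl)
    note pt = mut_equiv_preserves[OF st s]
    have t: "quantum_seed n h t" and V: "verts t = verts s" using pt by auto
    have k: "k \<in> muts t" "k \<in> verts t" using mu quantum_seed_muts[OF t] by (auto simp: mutates_def)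
    \<comment> \<open>Exponents must be nonnegative here: the inverse of a mutable variable may lie
      outside the cluster algebra, where \<open>g\<close> is not controlled.\<close>
    have monom: "Mm t a \<in> Fx" if "a \<in> vecs (verts t)" "\<forall>v. 0 \<le> a v" for a
      using quantum_seed_finite[OF t] that
    proof (induction rule: vecs_induct)
      case zero
      show ?case using cl[of 1] by (simp add: Mm_zero[OF t])
    next
      case (plus a w)
      have "0 \<le> a v" for v using plus(3) plus.prems[rule_format, of v] by (auto simp: unitv_def split: if_splits)
      then have "Mm t a \<in> Fx" using plus by blast
      moreover have "Mm t (unitv w) \<in> Fx" using step.IH plus V by auto
      ultimately show ?case
        using plus by (simp add: Mm_add[OF t] mult pow)
    next
      case (minus a w)
      then show ?case using minus.prems[rule_format, of w] by simp
    qed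
    \<comment> \<open>Multiplication by the old variable clears the only negative exponent, the -1
      at \<open>k\<close>.\<close>
    have exch: "Mm t (exch_vec t k (of_int e)) * Mm t (unitv k) \<in> Fx" for e
    proof -
      have "(\<lambda>v. exch_vec t k (of_int e) v + unitv k v) \<in> vecs (verts t)"
        using exch_vec_vecs[of t k] k(2) by (intro vecs_intros) auto
      then have "Mm t (\<lambda>v. exch_vec t k (of_int e) v + unitv k v) \<in> Fx"
        by (intro monom) (auto simp: exch_vec_eq[OF t k(1)])
      then show ?thesis
        using exch_vec_vecs[of t k] k(2) by (subst Mm_mult[OF t]) (auto intro: mult pow)
    qed
    have "Mm u (unitv k) \<in> Fx"
    proof (rule cancel)
      show "Mm u (unitv k) \<in> cluster_algebra n h s"
        using cluster_algebra_variable[OF su] k V by simp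
      show "Mm t (unitv k) \<in> Fx" using step.IH k V by simp
      show "Mm u (unitv k) * Mm t (unitv k) \<in> Fx"
        using mu add[OF exch[of 1] exch[of "-1"]] by (simp add: mutates_def distrib_right)
      show "Mm t (unitv k) \<noteq> 0" using Mm_nonzero[OF t] k by simp
    qed
    moreover have "Mm u (unitv v) = Mm t (unitv v)" if "v \<in> verts s - {k}" for v
      using mu V that by (simp add: mutates_def)
    ultimately show ?case using step.IH by (metis Diff_iff singletonD)
  qed
  have inv: "inverse (Mm s (unitv v)) \<in> Fx" if v: "v \<in> verts s - muts s" for v
  proof (rule cancel)
    show "Mm s (unitv v) \<in> Fx" using init v cluster_algebra_initial by (auto simp: Fx_def)
    show "Mm s (unitv v) \<noteq> 0" using Mm_nonzero[OF s] v by simp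
    then show "inverse (Mm s (unitv v)) * Mm s (unitv v) \<in> Fx" using cl[of 1] by simp
  qed (rule cluster_algebra_frozen_inverse[OF v])
  have "x \<in> Fx"
    using x unfolding cluster_algebra_def
  proof induction
    case (gen x)
    then show ?case using vars inv by blast
  qed (use cl add mult in auto)
  then show ?thesis by (simp add: Fx_def)
qed


section \<open>The seeds of the extended surface\<close>

lemma arrow_weight_eq:
  "arrow_weight x y = (if small_arrow 1 x y then (if co 3 x = 0 then 1 / 2 else 1) else 0) +
    (if small_arrow 2 x y then (if co 1 x = 0 then 1 / 2 else 1) else 0) +
    (if small_arrow 3 x y then (if co 2 x = 0 then 1 / 2 else 1) else 0)"
  by (simp add: arrow_weight_def nxt_def)

lemma small_arrow_simps:
  "small_arrow 1 (i, j, k) (i', j', k') \<longleftrightarrow> i = i' + 1 \<and> j' = j + 1 \<and> k = k'"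
  "small_arrow 2 (i, j, k) (i', j', k') \<longleftrightarrow> j = j' + 1 \<and> k' = k + 1 \<and> i = i'"
  "small_arrow 3 (i, j, k) (i', j', k') \<longleftrightarrow> k = k' + 1 \<and> i' = i + 1 \<and> j = j'"
  by (auto simp: small_arrow_def co_def nxt_def)

text \<open>Only the lines k = c - 1, c and c + 1 carry neighbours of (a, b, c). On each of them,
  when it occurs, there are exactly two, one at the tail of an arrow towards the point and one at
  the head of an arrow leaving it. Positivity of \<open>a\<close> and \<open>b\<close> keeps both
  neighbours in the triangle.\<close>

lemma arrow_weight_line_sum:
  assumes "a + b + c = n" "0 < a" "0 < b" "0 < k" "k < n"
  shows "(\<Sum>i = 0..n - k. arrow_weight (i, n - k - i, k) (a, b, c) -
    arrow_weight (a, b, c) (i, n - k - i, k)) = 0"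
proof -
  have xy: "arrow_weight (i, n - k - i, k) (a, b, c) =
      (if c = k \<and> i = a + 1 then 1 else 0) + (if c = k + 1 \<and> i = a then 1 else 0) +
      (if k = c + 1 \<and> i = a - 1 then 1 else 0)"
    and yx: "arrow_weight (a, b, c) (i, n - k - i, k) =
      (if c = k \<and> i = a - 1 then 1 else 0) + (if k = c + 1 \<and> i = a then 1 else 0) +
      (if c = k + 1 \<and> i = a + 1 then 1 else 0)"
    if "i \<in> {0..n - k}" for i
  proof -
    have i: "i \<le> n - k" using that by simp
    have "small_arrow 1 (i, n - k - i, k) (a, b, c) \<longleftrightarrow> c = k \<and> i = a + 1"
      "small_arrow 2 (i, n - k - i, k) (a, b, c) \<longleftrightarrow> c = k + 1 \<and> i = a"
      "small_arrow 3 (i, n - k - i, k) (a, b, c) \<longleftrightarrow> k = c + 1 \<and> i = a - 1"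
      "small_arrow 1 (a, b, c) (i, n - k - i, k) \<longleftrightarrow> c = k \<and> i = a - 1"
      "small_arrow 2 (a, b, c) (i, n - k - i, k) \<longleftrightarrow> k = c + 1 \<and> i = a"
      "small_arrow 3 (a, b, c) (i, n - k - i, k) \<longleftrightarrow> c = k + 1 \<and> i = a + 1"
      unfolding small_arrow_simps using assms i by linarith+
    \<comment> \<open>These two facts exclude arrows along the second and third sides, which would
      have weight 1/2. All the arrows counted here have weight 1.\<close>
    moreover have "c = k + 1 \<and> i = a \<longrightarrow> i \<noteq> 0" "k = c + 1 \<and> i = a - 1 \<longrightarrow> n - k - i \<noteq> 0"
      using assms by linarith+
    ultimately show "arrow_weight (i, n - k - i, k) (a, b, c) =
        (if c = k \<and> i = a + 1 then 1 else 0) + (if c = k + 1 \<and> i = a then 1 else 0) +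
        (if k = c + 1 \<and> i = a - 1 then 1 else 0)"
      "arrow_weight (a, b, c) (i, n - k - i, k) =
        (if c = k \<and> i = a - 1 then 1 else 0) + (if k = c + 1 \<and> i = a then 1 else 0) +
        (if c = k + 1 \<and> i = a + 1 then 1 else 0)"
      unfolding arrow_weight_eq using assms by (simp_all add: co_def)
  qed
  have sum: "(\<Sum>i = 0..n - k. arrow_weight (i, n - k - i, k) (a, b, c) -
      arrow_weight (a, b, c) (i, n - k - i, k)) = (\<Sum>i = 0..n - k.
      ((if c = k \<and> i = a + 1 then 1 else 0) + (if c = k + 1 \<and> i = a then 1 else 0) +
        (if k = c + 1 \<and> i = a - 1 then 1 else 0)) -
      ((if c = k \<and> i = a - 1 then 1 else 0) + (if k = c + 1 \<and> i = a then 1 else 0) +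
        (if c = k + 1 \<and> i = a + 1 then 1 else 0)))"
    by (intro sum.cong refl) (simp only: xy yx)
  consider "c = k" | "c = k + 1" | "k = c + 1" | "c \<noteq> k \<and> c \<noteq> k + 1 \<and> k \<noteq> c + 1" by blast
  then show ?thesis
  proof cases
    case 1
    then have "a + 1 \<le> n - k" "a - 1 \<le> n - k" using assms by linarith+
    then show ?thesis using 1 unfolding sum by (simp add: sum_subtractf)
  next
    case 2
    then have "a + 1 \<le> n - k" "a \<le> n - k" using assms by linarith+
    then show ?thesis using 2 unfolding sum by (simp add: sum_subtractf)
  next
    case 3
    then have "a \<le> n - k" "a - 1 \<le> n - k" using assms by linarith+
    then show ?thesis using 3 unfolding sum by (simp add: sum_subtractf)
  next
    case 4
    then show ?thesis unfolding sum by simp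
  qed
qed

section \<open>Small vertices of the attached triangles\<close>

lemma star_gl_Att:
  "((Att b, r), p) \<in> star_gl S F \<tau> \<Longrightarrow> r = 1"
  "(p, (Att b, r)) \<in> star_gl S F \<tau> \<Longrightarrow> r = 1"
  by (auto simp: star_gl_def)

text \<open>The first side, where the third coordinate vanishes, is the only glued side of an
  attached triangle, so points off it are identified with nothing.\<close>

lemma vcls_Att:
  assumes "k \<noteq> 0"
  shows "vcls n (star_gl S F \<tau>) (Att b) (i, j, k) = {(Att b, (i, j, k))}"
  using assms by (auto simp: vcls_def sidev_def dest: star_gl_Att)

lemma Vbar_smalls:
  assumes "v \<in> Vbar n T gl" "(t, x) \<in> v"
  shows "x \<in> smalls n"
proof -
  obtain t' y where v: "v = vcls n gl t' y" "y \<in> smalls n" using assms(1) unfolding Vbar_def by blast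
  then consider "x = y" | r a where "0 < a" "a < n" "x = sidev n r (n - a)"
    using assms(2) unfolding vcls_def by blast
  then show ?thesis using v(2) by cases (auto simp: sidev_def smalls_def)
qed

lemma Vbar_Att:
  assumes v: "v \<in> Vbar n (star_tris S F) (star_gl S F \<tau>)" and x: "(Att b, (i, j, k)) \<in> v" "k \<noteq> 0"
  shows "v = {(Att b, (i, j, k))} \<and> b \<in> bedges (opn S) \<and> (i, j, k) \<in> smalls n"
proof -
  obtain t y where v: "v = vcls n (star_gl S F \<tau>) t y" "t \<in> star_tris S F" "y \<in> smalls n"
    using v by (auto simp: Vbar_def)
  have "(Att b, (i, j, k)) = (t, y)"
  proof (rule ccontr)
    assume "(Att b, (i, j, k)) \<noteq> (t, y)"
    then obtain r r' a where "((t, r), (Att b, r')) \<in> star_gl S F \<tau>" "(i, j, k) = sidev n r' (n - a)"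
      using x(1) v(1) by (auto simp: vcls_def)
    then show False using x(2) by (auto simp: sidev_def dest!: star_gl_Att(2))
  qed
  then show ?thesis
    using v vcls_Att[OF x(2), of n S F \<tau> b i j] by (simp add: star_tris_def) blast
qed

lemma Att_in_Vbar:
  assumes "b \<in> bedges (opn S)" "(i, j, k) \<in> smalls n" "k \<noteq> 0"
  shows "{(Att b, (i, j, k))} \<in> Vbar n (star_tris S F) (star_gl S F \<tau>)"
proof -
  have "Att b \<in> star_tris S F" using assms by (auto simp: star_tris_def)
  then show ?thesis unfolding Vbar_def using assms vcls_Att[OF assms(3), of n S F \<tau> b i j, symmetric] by blast
qed

lemma not_Vprime_iff:
  "v \<in> Vbar n (star_tris S F) (star_gl S F \<tau>) - Vprime n (star_tris S F) (star_gl S F \<tau>) \<longleftrightarrow>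
    (\<exists>b k. b \<in> bedges (opn S) \<and> 0 < k \<and> k < n \<and> v = {(Att b, (0, n - k, k))})" (is "?l \<longleftrightarrow> ?r")
proof
  assume l: ?l
  then obtain b j k where x: "(Att b, (0, j, k)) \<in> v" by (auto simp: Vprime_def co_def)
  \<comment> \<open>Otherwise the point would be the corner (0, n, 0), which is not a small
    vertex.\<close>
  have "k \<noteq> 0"
  proof
    assume "k = 0"
    then show False
      using x l Vbar_smalls[of v n _ _ "Att b" "(0, j, k)"] by (auto simp: smalls_def)
  qed
  then have "v = {(Att b, (0, j, k))}" "b \<in> bedges (opn S)" "(0, j, k) \<in> smalls n"
    using Vbar_Att[OF _ x] l by blast+
  moreover from this(3) have "j = n - k" "k < n" by (auto simp: smalls_def)
  ultimately show ?r using \<open>k \<noteq> 0\<close> by blast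
next
  assume ?r
  then obtain b k where "b \<in> bedges (opn S)" "0 < k" "k < n" "v = {(Att b, (0, n - k, k))}" by blast
  then show ?l using Att_in_Vbar[of b S 0 "n - k" k n F \<tau>] by (auto simp: Vprime_def co_def smalls_def)
qed

lemma Vprime_not_Vlam_iff:
  "v \<in> Vprime n (star_tris S F) (star_gl S F \<tau>) - Vlam n (star_tris S F) (star_gl S F \<tau>) \<longleftrightarrow>
    (\<exists>b i j k. b \<in> bedges (opn S) \<and> i + j + k = n \<and> i \<noteq> 0 \<and> k \<noteq> 0 \<and> v = {(Att b, (i, j, k))})"
  (is "?l \<longleftrightarrow> ?r")
proof
  assume l: ?l
  then have V: "v \<in> Vbar n (star_tris S F) (star_gl S F \<tau>)" by (auto simp: Vprime_def)
  then obtain t x where tx: "(t, x) \<in> v" by (auto simp: Vbar_def vcls_def)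
  then obtain b where b: "t = Att b" "co 3 x \<noteq> 0"
    using l V by (cases t) (auto simp: Vlam_def)
  obtain i j k where x: "x = (i, j, k)" by (cases x) auto
  have k: "k \<noteq> 0" using b x by (simp add: co_def)
  have "\<nexists>b x. (Att b, x) \<in> v \<and> co 1 x = 0" using l by (simp add: Vprime_def)
  then have "co 1 x \<noteq> 0" using tx b(1) by metis
  then have "i \<noteq> 0" using x by (simp add: co_def)
  moreover have "v = {(Att b, (i, j, k))}" "b \<in> bedges (opn S)" "(i, j, k) \<in> smalls n"
    using Vbar_Att[OF V _ k] tx b x by blast+
  moreover from this(3) have "i + j + k = n" by (auto simp: smalls_def)
  ultimately show ?r using k by blast
next
  assume ?r
  then obtain b i j k where *: "b \<in> bedges (opn S)" "i + j + k = n" "i \<noteq> 0" "k \<noteq> 0"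
    "v = {(Att b, (i, j, k))}" by blast
  then have "v \<in> Vbar n (star_tris S F) (star_gl S F \<tau>)"
    using Att_in_Vbar[of b S i j k n F \<tau>] by (auto simp: smalls_def)
  then show ?l using * by (auto simp: Vprime_def Vlam_def co_def)
qed

lemma pshift_Att:
  assumes "k \<noteq> 0"
  shows "pshift n (star_gl S F \<tau>) {(Att b, (i, j, k))} = {(Att b, (0, n - k, k))}"
  unfolding pshift_def using assms by (intro the_equality) (auto simp: vcls_Att)

text \<open>The second and third sides of an attached triangle are unglued, so they lie on the
  boundary of the extended surface and carry frozen vertices only.\<close>

lemma Vmut_Vprime:
  assumes "v \<in> Vmut n (star_tris S F) (star_gl S F \<tau>)"
  shows "v \<in> Vprime n (star_tris S F) (star_gl S F \<tau>)"
    and "(Att b, (i, j, k)) \<in> v \<Longrightarrow> 0 < i \<and> 0 < j"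
proof -
  have 2: "co 1 x \<noteq> 0" "co 2 x \<noteq> 0" if "(Att b, x) \<in> v" for b x
  proof -
    have "co (nxt (nxt r)) x \<noteq> 0" if "r \<in> {2, 3}" for r
    proof
      assume "co (nxt (nxt r)) x = 0"
      moreover have "\<forall>(t, x) \<in> v. \<forall>r \<in> {1, 2, 3}. co (nxt (nxt r)) x = 0 \<longrightarrow>
          (t, r) \<in> Domain (star_gl S F \<tau>)"
        using assms unfolding Vmut_def by blast
      ultimately have "(Att b, r) \<in> Domain (star_gl S F \<tau>)"
        using \<open>(Att b, x) \<in> v\<close> that by auto
      then show False using that by (auto dest: star_gl_Att(1))
    qed
    from this[of 2] this[of 3] show "co 1 x \<noteq> 0" "co 2 x \<noteq> 0" by (simp_all add: nxt_def)
  qed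
  then show "v \<in> Vprime n (star_tris S F) (star_gl S F \<tau>)"
    using assms by (auto simp: Vprime_def Vmut_def)
  show "(Att b, (i, j, k)) \<in> v \<Longrightarrow> 0 < i \<and> 0 < j"
    using 2[of b "(i, j, k)"] by (simp add: co_def)
qed

lemma Qbar_singleton:
  "Qbar {(t, x)} v = (\<Sum>(t', y) \<in> v.
    if t = t' then arrow_weight x y - arrow_weight y x else 0)"
proof -
  have "inj_on (Pair (t, x)) v" by (simp add: inj_on_def)
  moreover have "{(t, x)} \<times> v = Pair (t, x) ` v" by auto
  ultimately show ?thesis
    unfolding Qbar_def by (simp only: sum.reindex o_def prod.case)
qed

text \<open>A mutable vertex on a glued side has representatives in several triangles. Those in the
  attached triangle \<open>b\<close> contribute zero by \<open>arrow_weight_line_sum\<close>, and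
  the others share no arrow with the line.\<close>

lemma Qbar_line_sum:
  assumes v: "v \<in> Vmut n (star_tris S F) (star_gl S F \<tau>)" and k: "0 < k" "k < n"
  shows "(\<Sum>i = 0..n - k. Qbar {(Att b, (i, n - k - i, k))} v) = 0"
proof -
  have "Qbar {(Att b, (i, n - k - i, k))} v = (\<Sum>(t, y) \<in> v.
      if Att b = t then arrow_weight (i, n - k - i, k) y - arrow_weight y (i, n - k - i, k) else 0)"
    (is "_ = (\<Sum>(t, y) \<in> v. ?w i t y)") for i
    by (rule Qbar_singleton)
  then have "(\<Sum>i = 0..n - k. Qbar {(Att b, (i, n - k - i, k))} v) =
      (\<Sum>i = 0..n - k. \<Sum>(t, y) \<in> v. ?w i t y)"
    by (rule sum.cong[OF refl])
  also have "\<dots> = (\<Sum>p \<in> v. \<Sum>i = 0..n - k. case p of (t, y) \<Rightarrow> ?w i t y)"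
    by (rule sum.swap)
  also have "\<dots> = (\<Sum>p \<in> v. 0)"
  proof (intro sum.cong refl)
    fix p assume "p \<in> v"
    then obtain t a b' c where y: "(t, (a, b', c)) \<in> v" and p: "p = (t, (a, b', c))"
      by (metis prod_cases4)
    show "(\<Sum>i = 0..n - k. case p of (t, y) \<Rightarrow> ?w i t y) = 0"
    proof (cases "t = Att b")
      case True
      have "a + b' + c = n" using v Vbar_smalls[OF _ y] by (auto simp: Vmut_def smalls_def)
      moreover have "0 < a" "0 < b'" using Vmut_Vprime(2)[OF v, of b a b' c] y True by simp_all
      ultimately have "(\<Sum>i = 0..n - k. arrow_weight (i, n - k - i, k) (a, b', c) -
          arrow_weight (a, b', c) (i, n - k - i, k)) = 0"
        using k by (rule arrow_weight_line_sum)
      then show ?thesis by (simp only: p True prod.case simp_thms if_True)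
    qed (simp add: p)
  qed
  finally show ?thesis by simp
qed


section \<open>The twist between the two seeds\<close>

text \<open>The subtracted operator reads coordinates in \<open>W\<close> only and writes outside
  \<open>W\<close>, so its square is zero and adding it instead of subtracting it gives the inverse.
  It writes at frozen vertices only, hence mutable coordinates stay.\<close>

lemma twisting_frozen_shift:
  assumes V: "finite V" and W: "W \<subseteq> V" and p: "\<And>v. v \<in> W \<Longrightarrow> p v \<in> V - U - W"
  shows "twisting V U (\<lambda>c u. c u - (\<Sum>v \<in> {v \<in> W. p v = u}. c v))"
proof -
  define D where "D c u = (\<Sum>v \<in> {v \<in> W. p v = u}. c v)" for c :: "'a \<Rightarrow> int" and u
  have D0: "D c u = 0" if "u \<notin> V \<or> u \<in> U \<or> u \<in> W" for c u
  proof -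
    have *: "{v \<in> W. p v = u} = {}" using p that by blast
    show ?thesis unfolding D_def * by simp
  qed
  have DD: "D (\<lambda>v. c v + x * D c v) u = D c u" for c x u
    unfolding D_def[of "\<lambda>v. c v + x * D c v"] D_def[of _ u] by (intro sum.cong) (auto simp: D0)
  have lin: "D (\<lambda>v. x * a v + y * b v) u = x * D a u + y * D b u" for a b x y u
    by (simp add: D_def sum.distrib sum_distrib_left)
  have "bij_betw (\<lambda>c u. c u - D c u) (vecs V) (vecs V)"
  proof (rule bij_betw_byWitness[where f' = "\<lambda>c u. c u + D c u"])
    show "\<forall>a \<in> vecs V. (\<lambda>u. a u - D a u + D (\<lambda>u. a u - D a u) u) = a"
      using DD[of _ "-1"] by simp
    show "\<forall>a \<in> vecs V. (\<lambda>u. a u + D a u - D (\<lambda>u. a u + D a u) u) = a"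
      using DD[of _ 1] by simp
  qed (auto simp: vecs_def D0)
  then have "twisting V U (\<lambda>c u. c u - D c u)"
    by (auto simp: twisting_def lin D0 algebra_simps)
  then show ?thesis by (simp add: D_def)
qed

lemma seed_qc_twisted:
  fixes S :: "'a pbsurf" and F :: "'f set" and s :: "(('f, 'a set) tri vert, 'k::division_ring) qseed"
  assumes s: "quantum_seed n h s"
    and V: "verts s = Vbar n (star_tris S F) (star_gl S F \<tau>)"
    and U: "muts s = Vmut n (star_tris S F) (star_gl S F \<tau>)"
    and Q: "\<forall>v \<in> verts s. \<forall>w \<in> verts s. Qm s v w = Qbar v w"
  shows "\<exists>L. twisted n h s (seed_qc n (star_tris S F) (star_gl S F \<tau>) s) L"
proof -
  define T where "T = star_tris S F"
  define gl where "gl = star_gl S F \<tau>"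
  define V' where "V' = Vprime n T gl"
  define W where "W = V' - Vlam n T gl"
  define p where "p = pshift n gl"
  define s' where "s' = seed_qc n T gl s"
  note defs = T_def gl_def
  have V'V: "V' \<subseteq> verts s" by (auto simp: V'_def Vprime_def V defs)
  have UV': "muts s \<subseteq> V'" using Vmut_Vprime(1)[of _ n S F \<tau>] by (auto simp: V'_def U defs)
  have W_iff: "v \<in> W \<longleftrightarrow>
      (\<exists>b i j k. b \<in> bedges (opn S) \<and> i + j + k = n \<and> i \<noteq> 0 \<and> k \<noteq> 0 \<and> v = {(Att b, (i, j, k))})" for v
    unfolding W_def V'_def defs by (rule Vprime_not_Vlam_iff)
  have B_iff: "v \<in> verts s - V' \<longleftrightarrow>
      (\<exists>b k. b \<in> bedges (opn S) \<and> 0 < k \<and> k < n \<and> v = {(Att b, (0, n - k, k))})" for v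
    unfolding V V'_def defs by (rule not_Vprime_iff)
  have p: "p {(Att b, (i, j, k))} = {(Att b, (0, n - k, k))}" if "k \<noteq> 0" for b i j k
    using that unfolding p_def defs by (rule pshift_Att)
  have pW: "p v \<in> verts s - V'" if v: "v \<in> W" for v
  proof -
    obtain b i j k where *: "b \<in> bedges (opn S)" "i + j + k = n" "i \<noteq> 0" "k \<noteq> 0"
      "v = {(Att b, (i, j, k))}"
      using v unfolding W_iff by blast
    then have "0 < k" "k < n" by linarith+
    then show ?thesis unfolding B_iff using * p by blast
  qed
  define L where "L = (\<lambda>(c :: _ \<Rightarrow> int) u. c u - (\<Sum>v \<in> {v \<in> W. p v = u}. c v))"
  have L: "twisting (verts s) (muts s) L"
    unfolding L_def
    by (rule twisting_frozen_shift[OF quantum_seed_finite[OF s]]) (use pW UV' V'V in \<open>auto simp: W_def\<close>)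
  have qc: "qc_vec n T gl v u = unitv v u - (if v \<in> W \<and> p v = u then 1 else 0)" for v u
    unfolding qc_vec_def W_def[unfolded V'_def, symmetric] p_def[symmetric] by (auto simp: unitv_def)
  have fW: "finite W" using quantum_seed_finite[OF s] V'V by (auto simp: W_def intro: finite_subset)
  have Lqc: "L (unitv v) = qc_vec n T gl v" for v
  proof
    fix u
    have "(\<Sum>w \<in> {w \<in> W. p w = u}. unitv v w) = (\<Sum>w \<in> {w \<in> W. p w = u}. if w = v then 1 else 0)"
      by (intro sum.cong) (auto simp: unitv_def)
    also have "\<dots> = (if v \<in> W \<and> p v = u then 1 else 0)" using fW by simp
    finally show "L (unitv v) u = qc_vec n T gl v u" by (simp add: L_def qc)
  qed
  have sel: "verts s' = verts s" "muts s' = muts s"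
    "Qm s' = (\<lambda>v w. if v \<in> V' \<and> w \<in> V' then Qm s v w else 0)"
    "Pm s' = (\<lambda>v w. bform s (qc_vec n T gl v) (qc_vec n T gl w))"
    "Mm s' = (\<lambda>c. Mm s (\<lambda>u. \<Sum>v \<in> verts s. c v * qc_vec n T gl v u))"
    by (simp_all add: s'_def seed_qc_def V'_def bform_def)
  have "twisted n h s s' L"
  proof (rule twistedI[OF s L])
    fix u v assume uv: "u \<in> verts s" "v \<in> verts s"
    show "Qm s' u v = - Qm s' v u" using quantum_seed_skew[OF s uv] by (simp add: sel)
    show "2 * Qm s' u v \<in> \<int>" using quantum_seed_half_int[OF s uv] by (simp add: sel)
    show "Pm s' u v = bform s (L (unitv u)) (L (unitv v))" by (simp add: sel Lqc)
  next
    fix u v assume "u \<in> verts s" "v \<in> muts s"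
    then show "Qm s' u v \<in> \<int>" using quantum_seed_int[OF s] by (simp add: sel)
  next
    fix a assume "a \<in> vecs (verts s)"
    from twisting_expand[OF quantum_seed_finite[OF s] L this]
    show "Mm s' a = Mm s (L a)" by (simp add: sel Lqc)
  next
    fix v assume v: "v \<in> muts s"
    then have vV': "v \<in> V'" "v \<in> verts s" using UV' V'V by auto
    have Qc: "Qcol s' v u = (if u \<in> V' then Qcol s v u else 0)" for u
      using vV' V'V by (auto simp: Qcol_def sel)
    show "L (Qcol s' v) = Qcol s v"
    proof
      fix u
      have eq: "L (Qcol s' v) u = Qcol s' v u - (\<Sum>w \<in> {w \<in> W. p w = u}. Qcol s v w)"
        unfolding L_def by (auto simp: Qc W_def intro!: sum.cong)
      show "L (Qcol s' v) u = Qcol s v u"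
      proof (cases "u \<in> verts s - V'")
        case False
        then have *: "{w \<in> W. p w = u} = {}" using pW by auto
        have "u \<notin> V' \<longrightarrow> Qcol s v u = 0" using False by (simp add: Qcol_def)
        then show ?thesis unfolding eq * by (simp add: Qc)
      next
        case True
        then obtain b k where b: "b \<in> bedges (opn S)" and k: "0 < k" "k < n"
          and u: "u = {(Att b, (0, n - k, k))}" unfolding B_iff by blast
        define e :: "nat \<Rightarrow> ('f, 'a set) tri vert" where
          "e i = {(Att b, (i, n - k - i, k))}" for i
        \<comment> \<open>The fibre of the shift over \<open>u\<close> is the line through
          \<open>u\<close> without \<open>u\<close> itself. Here \<open>u\<close> is the point with
          i = 0, and the range includes i = n - k, which lies on the third side.\<close>
        have fib: "{w \<in> W. p w = u} = e ` {1..n - k}"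
        proof (intro equalityI subsetI)
          fix w assume "w \<in> {w \<in> W. p w = u}"
          then have "w \<in> W" "p w = u" by auto
          then obtain b' i j k' where *: "i + j + k' = n" "i \<noteq> 0" "k' \<noteq> 0"
            "w = {(Att b', (i, j, k'))}" "p w = u"
            unfolding W_iff by blast
          then have "b' = b" "k' = k" using p[of k' b' i j] u by auto
          then have "w = e i" "i \<in> {1..n - k}" using * by (auto simp: e_def)
          then show "w \<in> e ` {1..n - k}" by blast
        next
          fix w assume "w \<in> e ` {1..n - k}"
          then obtain i where i: "i \<in> {1..n - k}" "w = e i" by blast
          have "i + (n - k - i) + k = n" "i \<noteq> 0" "k \<noteq> 0" using i k by auto
          then have "w \<in> W" unfolding W_iff i(2) e_def using b by blast
          moreover have "p w = u" unfolding i(2) e_def u by (rule p) (use k in simp)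
          ultimately show "w \<in> {w \<in> W. p w = u}" by simp
        qed
        have inj: "inj_on e A" for A by (auto simp: inj_on_def e_def)
        have e0: "e 0 = u" by (simp add: e_def u)
        have eV: "e i \<in> verts s" if "i \<in> {0..n - k}" for i
          using that fib e0 True V'V by (cases "i = 0") (auto simp: W_def)
        \<comment> \<open>The sum starts at 0 to include the entry at \<open>u\<close>. Its
          vanishing says that this entry is minus the fibre sum, which is what \<open>L\<close>
          produces after the entry itself was deleted.\<close>
        have "rat_of_int (\<Sum>i = 0..n - k. Qcol s v (e i)) = (\<Sum>i = 0..n - k. Qbar (e i) v)"
          unfolding of_int_sum
          using of_int_Qcol[OF s eV v] eV Q vV'(2) by (intro sum.cong refl) simp
        also have "\<dots> = 0" unfolding e_def using Qbar_line_sum[OF _ k] v U by simp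
        finally have "(\<Sum>i = 0..n - k. Qcol s v (e i)) = 0"
          by (simp only: of_int_eq_0_iff)
        moreover have "(\<Sum>i = 0..n - k. Qcol s v (e i)) = Qcol s v u + (\<Sum>i = 1..n - k. Qcol s v (e i))"
          by (simp add: sum.atLeast_Suc_atMost e0)
        moreover have "(\<Sum>w \<in> {w \<in> W. p w = u}. Qcol s v w) = (\<Sum>i = 1..n - k. Qcol s v (e i))"
          unfolding fib by (simp add: sum.reindex[OF inj])
        ultimately show ?thesis using True by (simp add: eq Qc)
      qed
    qed
  qed (simp_all add: sel)
  then show ?thesis unfolding s'_def defs by blast
qed

theorem proposition4p12:
  fixes n :: nat
    and S :: "'a pbsurf" and \<Lambda> :: "'a set set"
    and F :: "'f set" and \<tau> :: "'f \<Rightarrow> complex \<Rightarrow> 'a"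
    and h :: "'k::division_ring"
    and tr :: "((('f, 'a set) tri \<times> complex) set dgm \<Rightarrow>\<^sub>0 lring) set \<Rightarrow> 'k"
    and sbar sqc :: "(('f, 'a set) tri vert, 'k) qseed"
  defines "T \<equiv> star_tris S F" and "gl \<equiv> star_gl S F \<tau>"
  assumes "n \<ge> 1"
    and "pb_surface S" and "generalized_triangulable S" and "no_interior_punctures S"
    and "generalized_triangulation S \<Lambda>" and "faces_of S \<Lambda> F \<tau>"
    and "is_seed_bar n T gl h tr sbar"
    and "sqc = seed_qc n T gl sbar"
  shows "\<exists>f. quasi_iso n h sqc h sbar f \<and>
           (\<forall>v \<in> Vbar n T gl. f (Mm sqc (unitv v)) = Mm sbar (qc_vec n T gl v)) \<and>
           (\<forall>g. alg_hom h (cluster_algebra n h sqc) h (cluster_algebra n h sbar) g \<and>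
                (\<forall>v \<in> Vbar n T gl. g (Mm sqc (unitv v)) = Mm sbar (qc_vec n T gl v))
                \<longrightarrow> (\<forall>x \<in> cluster_algebra n h sqc. g x = f x))"
proof -
  have s: "quantum_seed n h sbar" and V: "verts sbar = Vbar n T gl"
    and U: "muts sbar = Vmut n T gl"
    and Q: "\<forall>v \<in> verts sbar. \<forall>w \<in> verts sbar. Qm sbar v w = Qbar v w"
    using \<open>is_seed_bar n T gl h tr sbar\<close> unfolding is_seed_bar_def Let_def by - (elim conjE; assumption)+
  obtain L where tw: "twisted n h sbar sqc L"
    using seed_qc_twisted[OF s V[unfolded T_def gl_def] U[unfolded T_def gl_def] Q]
      \<open>sqc = seed_qc n T gl sbar\<close> unfolding T_def gl_def by blast
  have sq: "quantum_seed n h sqc" and Vq: "verts sqc = Vbar n T gl"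
    using tw V by (auto simp: twisted_def)
  have var: "Mm sqc (unitv v) = Mm sbar (qc_vec n T gl v)" if v: "v \<in> Vbar n T gl" for v
  proof -
    have "(\<Sum>w \<in> verts sbar. unitv v w * qc_vec n T gl w u) = qc_vec n T gl v u" for u
    proof -
      have "(\<Sum>w \<in> verts sbar. unitv v w * qc_vec n T gl w u) =
          (\<Sum>w \<in> verts sbar. if w = v then qc_vec n T gl w u else 0)"
        by (intro sum.cong) (auto simp: unitv_def)
      then show ?thesis using quantum_seed_finite[OF s] v V by simp
    qed
    then show ?thesis using \<open>sqc = seed_qc n T gl sbar\<close> by (simp add: seed_qc_def)
  qed
  show ?thesis
  proof (intro exI[of _ "\<lambda>x. x"] conjI allI impI ballI)
    show "quasi_iso n h sqc h sbar (\<lambda>x. x)"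
      by (rule twisted_quasi_iso[OF tw \<open>n \<ge> 1\<close>])
    show "Mm sqc (unitv v) = Mm sbar (qc_vec n T gl v)" if "v \<in> Vbar n T gl" for v
      by (rule var[OF that])
    \<comment> \<open>Uniqueness: by \<open>var\<close> the prescribed values of \<open>g\<close>
      are the initial variables of \<open>sqc\<close> themselves, so \<open>g\<close> fixes the
      initial seed.\<close>
    fix g x
    assume g: "alg_hom h (cluster_algebra n h sqc) h (cluster_algebra n h sbar) g \<and>
      (\<forall>v \<in> Vbar n T gl. g (Mm sqc (unitv v)) = Mm sbar (qc_vec n T gl v))"
      and x: "x \<in> cluster_algebra n h sqc"
    show "g x = x"
      by (rule alg_hom_determined_by_seed[OF sq conjunct1[OF g] _ x]) (use g var Vq in auto)
  qed
qed

end
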